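(* Let $n\ge 1$. Every positive definite function $\phi:S_n\to\mathcal{L}(\mathcal{H})$ with $\phi(e)=I_{\mathcal{H}}$ has a positive definite extension $\Phi:\mathbb{F}\to\mathcal{L}(\mathcal{H})$. If $\phi$ is radial (that is, $\phi(s)$ depends only on $|s|$), then one can choose $\Phi$ to be radial as well.
   Context: $\mathcal{H}$ is a Hilbert space and $\mathcal{L}(\mathcal{H})$ its bounded operators. $\mathbb{F}$ is the free group with finitely many generators $a_1,\dots,a_m$, $e$ is its unit, $|s|$ is the length of the reduced word $s$, and $S_n=\{s\in\mathbb{F}:|s|\le n\}$. For $\Sigma=\Sigma^{-1}\subset\mathbb{F}$, a function $\phi:\Sigma\to\mathcal{L}(\mathcal{H})$ is positive definite if for all $s_1,\dots,s_k\in\mathbb{F}$ with $s_i^{-1}s_j\in\Sigma$ for all $i,j$, the operator matrix $[\phi(s_i^{-1}s_j)]_{i,j=1}^k$ is positive semidefinite. *)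

theory Defs
  imports "HOL-Analysis.Analysis" "HOL-Algebra.Group"
begin

section \<open>Complex Hilbert spaces and their bounded operators\<close>

text \<open>
  The complex inner product is linear in the first argument.  Its real part is the real inner
  product, so \<open>norm x\<close> is the norm induced by \<open>cinner\<close>.  Positivity and definiteness
  of \<open>cinner\<close> and the law \<open>1 *\<^sub>C x = x\<close> follow from the real structure.
\<close>

class complex_inner = real_inner +
  fixes scaleC :: "complex \<Rightarrow> 'a \<Rightarrow> 'a"  (infixr \<open>*\<^sub>C\<close> 75)
    and cinner :: "'a \<Rightarrow> 'a \<Rightarrow> complex"
  assumes scaleC_add_right: "c *\<^sub>C (x + y) = c *\<^sub>C x + c *\<^sub>C y"
    and scaleC_add_left: "(c + d) *\<^sub>C x = c *\<^sub>C x + d *\<^sub>C x"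
    and scaleC_scaleC: "c *\<^sub>C (d *\<^sub>C x) = (c * d) *\<^sub>C x"
    and scaleR_scaleC: "r *\<^sub>R x = complex_of_real r *\<^sub>C x"
    and cinner_commute: "cinner x y = cnj (cinner y x)"
    and cinner_add_left: "cinner (x + y) z = cinner x z + cinner y z"
    and cinner_scaleC_left: "cinner (c *\<^sub>C x) y = c * cinner x y"
    and inner_eq_Re_cinner: "inner x y = Re (cinner x y)"

class chilbert_space = complex_inner + complete_space

instantiation complex :: chilbert_space
begin

definition scaleC_complex :: "complex \<Rightarrow> complex \<Rightarrow> complex" where
  "scaleC_complex c x = c * x"

definition cinner_complex :: "complex \<Rightarrow> complex \<Rightarrow> complex" where
  "cinner_complex x y = x * cnj y"

instance
  by standard
    (simp_all add: scaleC_complex_def cinner_complex_def algebra_simps scaleR_conv_of_real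
      inner_complex_def)

end

lemma cinner_self: "cinner x x = complex_of_real ((norm x)\<^sup>2)"
  for x :: "'h::complex_inner"
proof (rule complex_eqI)
  show "Re (cinner x x) = Re (complex_of_real ((norm x)\<^sup>2))"
    by (simp flip: inner_eq_Re_cinner add: power2_norm_eq_inner)
  have "Im (cinner x x) = - Im (cinner x x)"
    using arg_cong[OF cinner_commute[of x x], of Im] by simp
  then show "Im (cinner x x) = Im (complex_of_real ((norm x)\<^sup>2))" by simp
qed

text \<open>The type of \<open>blinfun\<close> only provides real-linear maps.\<close>

definition bounded_operators :: "('h::complex_inner \<Rightarrow>\<^sub>L 'h) set" where
  "bounded_operators =
     {T. \<forall>c x. blinfun_apply T (c *\<^sub>C x) = c *\<^sub>C blinfun_apply T x}"

text \<open>
  Positive semidefiniteness of the operator matrix \<open>M = [T i j]\<close> for \<open>i, j < k\<close> on the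
  \<open>k\<close>-fold direct sum of the space: the double sum is the inner product of \<open>M h\<close> with
  \<open>h\<close>, where only the entries \<open>h i\<close> with \<open>i < k\<close> matter.
\<close>

definition psd_operator_matrix ::
    "nat \<Rightarrow> (nat \<Rightarrow> nat \<Rightarrow> 'h::complex_inner \<Rightarrow>\<^sub>L 'h) \<Rightarrow> bool" where
  "psd_operator_matrix k T \<longleftrightarrow>
     (\<forall>h :: nat \<Rightarrow> 'h.
        (\<Sum>i<k. cinner (\<Sum>j<k. blinfun_apply (T i j) (h j)) (h i)) \<in> \<real> \<and>
        0 \<le> Re (\<Sum>i<k. cinner (\<Sum>j<k. blinfun_apply (T i j) (h j)) (h i)))"


section \<open>Free groups\<close>

text \<open>
  The letter \<open>(a, True)\<close> stands for the generator \<open>a\<close> and \<open>(a, False)\<close> for its inverse.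
  Elements of the free group are the reduced words, so \<open>length\<close> is the word length.
\<close>

type_synonym 'g word = "('g \<times> bool) list"

definition flip :: "'g \<times> bool \<Rightarrow> 'g \<times> bool" where
  "flip x = (fst x, \<not> snd x)"

fun reduced :: "'g word \<Rightarrow> bool" where
  "reduced (x # y # w) \<longleftrightarrow> y \<noteq> flip x \<and> reduced (y # w)"
| "reduced _ \<longleftrightarrow> True"

fun push :: "'g \<times> bool \<Rightarrow> 'g word \<Rightarrow> 'g word" where
  "push x [] = [x]"
| "push x (y # w) = (if y = flip x then w else x # y # w)"

definition reduce :: "'g word \<Rightarrow> 'g word" where
  "reduce w = foldr push w []"

definition free_group :: "'g set \<Rightarrow> 'g word monoid" where
  "free_group A =
     \<lparr>carrier = {w. reduced w \<and> fst ` set w \<subseteq> A},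
      mult = (\<lambda>u v. reduce (u @ v)),
      one = []\<rparr>"

definition word_ball :: "'g set \<Rightarrow> nat \<Rightarrow> 'g word set" where
  "word_ball A n = {s \<in> carrier (free_group A). length s \<le> n}"

lemma flip_flip [simp]: "flip (flip x) = x"
  by (simp add: flip_def)

lemma flip_neq [simp]: "flip x \<noteq> x" "x \<noteq> flip x"
  by (auto simp: flip_def prod_eq_iff)

lemma fst_flip [simp]: "fst (flip x) = fst x"
  by (simp add: flip_def)

lemma reduced_Cons: "reduced (x # w) \<Longrightarrow> reduced w"
  by (cases w) auto

lemma reduced_push: "reduced w \<Longrightarrow> reduced (push x w)"
  by (cases w) (auto dest: reduced_Cons)

lemma reduced_foldr_push: "reduced w \<Longrightarrow> reduced (foldr push u w)"
  by (induction u) (auto intro: reduced_push)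

lemma push_flip: "reduced w \<Longrightarrow> push x (push (flip x) w) = w"
proof (cases w)
  case (Cons y v)
  assume "reduced w"
  then show ?thesis using Cons by (cases v) auto
qed simp

lemma reduce_reduced: "reduced w \<Longrightarrow> reduce w = w"
proof (induction w)
  case (Cons x w)
  then have "reduce w = w" using reduced_Cons by blast
  then show ?case using Cons.prems by (cases w) (auto simp: reduce_def)
qed (simp add: reduce_def)

lemma reduced_reduce: "reduced (reduce w)"
  by (simp add: reduce_def reduced_foldr_push)

lemma reduce_append: "reduced v \<Longrightarrow> reduce (u @ v) = foldr push u v"
  using reduce_reduced[of v] by (simp add: reduce_def)

lemma foldr_push_push:
  assumes "reduced w"
  shows "foldr push (push x t) w = push x (foldr push t w)"
proof (cases t)
  case (Cons y ys)
  then show ?thesis using assms by (auto simp: push_flip reduced_foldr_push)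
qed simp

lemma foldr_push_assoc:
  "reduced w \<Longrightarrow> foldr push (foldr push u v) w = foldr push u (foldr push v w)"
  by (induction u) (auto simp: foldr_push_push)

lemma set_push: "set (push x w) \<subseteq> insert x (set w)"
  by (cases w) auto

lemma set_foldr_push: "set (foldr push u w) \<subseteq> set u \<union> set w"
proof (induction u)
  case (Cons x u)
  then show ?case using set_push[of x "foldr push u w"] by auto
qed simp

lemma set_reduce: "set (reduce w) \<subseteq> set w"
  using set_foldr_push[of w "[]"] by (simp add: reduce_def)

lemma foldr_push_rev_flip: "reduced w \<Longrightarrow> foldr push (rev (map flip u)) (foldr push u w) = w"
proof (induction u arbitrary: w)
  case (Cons x u)
  have "push (flip x) (push x (foldr push u w)) = foldr push u w"
    using push_flip[of "foldr push u w" "flip x"] Cons.prems by (simp add: reduced_foldr_push)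
  then show ?case using Cons by simp
qed simp

lemma reduced_snoc:
  "reduced (w @ [x, y]) \<longleftrightarrow> reduced (w @ [x]) \<and> y \<noteq> flip x"
proof (induction w)
  case (Cons a w)
  then show ?case by (cases w) auto
qed auto

lemma reduced_rev_flip: "reduced w \<Longrightarrow> reduced (rev (map flip w))"
proof (induction w rule: reduced.induct)
  case (1 x y w)
  then show ?case using reduced_snoc[of "rev (map flip w)" "flip y" "flip x"] by auto
qed auto

lemma free_group_inverse:
  assumes "w \<in> carrier (free_group A)"
  shows "rev (map flip w) \<in> carrier (free_group A)"
    and "rev (map flip w) \<otimes>\<^bsub>free_group A\<^esub> w = \<one>\<^bsub>free_group A\<^esub>"
proof -
  show "rev (map flip w) \<in> carrier (free_group A)"
    using assms by (auto simp: free_group_def reduced_rev_flip)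
  have "reduced w" using assms by (simp add: free_group_def)
  then show "rev (map flip w) \<otimes>\<^bsub>free_group A\<^esub> w = \<one>\<^bsub>free_group A\<^esub>"
    using foldr_push_rev_flip[of "[]" w] reduce_reduced[of w]
    by (simp add: free_group_def reduce_append) (simp add: reduce_def)
qed

lemma group_free_group: "group (free_group A)"
proof (rule groupI)
  fix u v assume "u \<in> carrier (free_group A)" "v \<in> carrier (free_group A)"
  then show "u \<otimes>\<^bsub>free_group A\<^esub> v \<in> carrier (free_group A)"
    using set_reduce[of "u @ v"] by (fastforce simp: free_group_def reduced_reduce)
next
  fix u v w
  assume "u \<in> carrier (free_group A)" "v \<in> carrier (free_group A)" "w \<in> carrier (free_group A)"
  then show "u \<otimes>\<^bsub>free_group A\<^esub> v \<otimes>\<^bsub>free_group A\<^esub> w =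
      u \<otimes>\<^bsub>free_group A\<^esub> (v \<otimes>\<^bsub>free_group A\<^esub> w)"
    by (simp add: free_group_def reduce_append reduced_foldr_push foldr_push_assoc)
next
  fix w assume "w \<in> carrier (free_group A)"
  then show "\<exists>v\<in>carrier (free_group A). v \<otimes>\<^bsub>free_group A\<^esub> w = \<one>\<^bsub>free_group A\<^esub>"
    using free_group_inverse by blast
qed (auto simp: free_group_def reduce_reduced)

lemma inv_free_group:
  "w \<in> carrier (free_group A) \<Longrightarrow> inv\<^bsub>free_group A\<^esub> w = rev (map flip w)"
  using group.inv_equality[OF group_free_group] free_group_inverse by blast

lemma word_ball_inv: "s \<in> word_ball A n \<Longrightarrow> inv\<^bsub>free_group A\<^esub> s \<in> word_ball A n"
  by (auto simp: word_ball_def inv_free_group free_group_inverse(1))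


section \<open>Positive definite and radial functions\<close>

text \<open>Meant for symmetric subsets \<open>\<Sigma>\<close> of the carrier of a group \<open>G\<close>; the values of \<open>\<phi>\<close> outside \<open>\<Sigma>\<close> are irrelevant.\<close>

definition positive_definite_on ::
    "('a, 'b) monoid_scheme \<Rightarrow> 'a set \<Rightarrow> ('a \<Rightarrow> 'h::complex_inner \<Rightarrow>\<^sub>L 'h) \<Rightarrow> bool" where
  "positive_definite_on G \<Sigma> \<phi> \<longleftrightarrow>
     (\<forall>(k::nat) (s :: nat \<Rightarrow> 'a).
        (\<forall>i<k. s i \<in> carrier G) \<longrightarrow>
        (\<forall>i<k. \<forall>j<k. inv\<^bsub>G\<^esub> (s i) \<otimes>\<^bsub>G\<^esub> s j \<in> \<Sigma>) \<longrightarrow>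
        psd_operator_matrix k (\<lambda>i j. \<phi> (inv\<^bsub>G\<^esub> (s i) \<otimes>\<^bsub>G\<^esub> s j)))"

definition radial_on :: "'g word set \<Rightarrow> ('g word \<Rightarrow> 'c) \<Rightarrow> bool" where
  "radial_on \<Sigma> \<phi> \<longleftrightarrow> (\<forall>s\<in>\<Sigma>. \<forall>t\<in>\<Sigma>. length s = length t \<longrightarrow> \<phi> s = \<phi> t)"

end

theory Submission
  imports Defs "HOL-Library.Function_Algebras"
begin

text \<open>
  A positive definite function \<open>\<phi>\<close> on the ball of radius \<open>n\<close> is the same as an operator kernel
  \<open>K(x, y) = \<phi>(x\<inverse>y)\<close> that is prescribed for words at distance at most \<open>n\<close> in the word metric
  \<open>d(x, y) = |x\<inverse>y|\<close> and is positive semidefinite on every finite set of diameter at most \<open>n\<close>.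
  It suffices to extend from radius \<open>n\<close> to radius \<open>n + 1\<close> and to iterate: every finite set has finite
  diameter, so the common extension is positive definite on the whole group.

  The step uses the central (Markov) choice.  For \<open>x\<close>, \<open>y\<close> at distance \<open>n + 1\<close> let the separator
  \<open>B\<close> consist of the words at distance at most \<open>n\<close> from both.  In a Hilbert space in which \<open>K\<close> is a
  Gram kernel, \<open>K(x, y)\<close> is declared to be the inner product of the projections of the vectors at
  \<open>x\<close> and \<open>y\<close> to the span of the vectors at \<open>B\<close>.

  Positivity rests on the word metric being a tree metric, through the four-point condition.
  In a finite set \<open>Z\<close> of diameter \<open>n + 1\<close>, all pairs at distance \<open>n + 1\<close> have the same separator
  \<open>B\<close> (they have the same midpoint), the relation \<open>d(x, y) \<le> n\<close> is an equivalence relation on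
  \<open>Z - B\<close>, and \<open>B\<close> together with one class has diameter at most \<open>n\<close>.  So every \<open>B \<union> class\<close> carries a
  positive semidefinite kernel, and different classes are coupled centrally over \<open>B\<close>.  Removing
  the projections to \<open>B\<close> from the vectors of the classes leaves mutually orthogonal positive
  semidefinite blocks, so the kernel on \<open>Z\<close> is positive semidefinite
  (\<open>psd_kernel_on_amalgam\<close>, \<open>psd_kernel_on_central_completion\<close>).

  The central value depends only on the kernel on \<open>B\<close> and between \<open>B\<close> and the two points, so it is
  carried along by every symmetry that preserves these data.  Left translations show that the new
  values again depend on \<open>x\<inverse>y\<close> only, and multiplication by \<open>\<i>\<close> shows that they are complex linear.
  If \<open>\<phi>\<close> is radial, then \<open>K\<close> depends on distances alone, and the automorphisms of the Cayley tree that fix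
  the unit, which act transitively on each sphere, show that the extension is radial.

  The projections are never formed.  The squared length of the projection of a vector is
  the supremum over \<open>h\<close> of \<open>2 l(h) - q(h)\<close>, where \<open>q\<close> is the quadratic form of \<open>K\<close> on \<open>B\<close> and \<open>l\<close> is the
  functional given by pairing with the vector.  This supremum makes sense for a degenerate form on
  a space that is not complete.  It satisfies the parallelogram law, so it
  polarizes to a bilinear form, and Riesz representation turns that form into an operator.
  Only real parts of inner products are used for this; Hermitian symmetry is recovered from real
  symmetry and complex linearity.
\<close>

section \<open>Quadratic forms and their duals\<close>

instantiation "fun" :: (type, real_vector) real_vector
begin
definition scaleR_fun :: "real \<Rightarrow> ('a \<Rightarrow> 'b) \<Rightarrow> 'a \<Rightarrow> 'b" where
  "scaleR_fun r f = (\<lambda>x. r *\<^sub>R f x)"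
instance
  by standard (simp_all add: scaleR_fun_def plus_fun_def fun_eq_iff scaleR_add_right scaleR_add_left)
end

lemma sum_fun_apply: "(\<Sum>i\<in>S. f i) x = (\<Sum>i\<in>S. f i x)"
  for f :: "'a \<Rightarrow> 'b \<Rightarrow> 'c::comm_monoid_add"
  by (induction S rule: infinite_finite_induct) (simp_all add: zero_fun_def plus_fun_def)

definition quadratic :: "('v::real_vector \<Rightarrow> real) \<Rightarrow> bool" where
  "quadratic Q \<longleftrightarrow> (\<forall>v. 0 \<le> Q v) \<and> (\<forall>t v. Q (t *\<^sub>R v) = t\<^sup>2 * Q v) \<and>
     (\<forall>v w. Q (v + w) + Q (v - w) = 2 * Q v + 2 * Q w)"

definition polar :: "('v::real_vector \<Rightarrow> real) \<Rightarrow> 'v \<Rightarrow> 'v \<Rightarrow> real" where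
  "polar Q v w = (Q (v + w) - Q (v - w)) / 4"

text \<open>
  The defect \<open>A t - t * A 1\<close> is additive and vanishes at the integers, so it is periodic and hence
  bounded everywhere; an additive function that is bounded everywhere is zero.
\<close>

lemma additive_bounded_imp_homogeneous:
  fixes A :: "real \<Rightarrow> real"
  assumes add: "\<And>s t. A (s + t) = A s + A t"
    and bound: "\<And>t. \<bar>t\<bar> \<le> 1 \<Longrightarrow> \<bar>A t\<bar> \<le> M"
  shows "A t = t * A 1"
proof -
  define D where "D t = A t - t * A 1" for t
  have D_add: "D (s + t) = D s + D t" for s t
    by (simp add: D_def add algebra_simps)
  have D_nat: "D (real k * t) = real k * D t" for k t
  proof (induction k)
    case 0
    show ?case using D_add[of 0 0] by simp
  next
    case (Suc k)
    then show ?case using D_add[of "real k * t" t] by (simp add: algebra_simps)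
  qed
  have D_minus: "D (- t) = - D t" for t
    using D_add[of t "- t"] D_nat[of 0 0] by simp
  have D_int: "D (of_int k) = 0" for k
  proof (cases "k \<ge> 0")
    case True
    then show ?thesis using D_nat[of "nat k" 1] by (simp add: D_def)
  next
    case False
    then show ?thesis using D_nat[of "nat (- k)" 1] D_minus[of "of_int k"] by (simp add: D_def)
  qed
  have bnd: "\<bar>D t\<bar> \<le> M + \<bar>A 1\<bar>" for t
  proof -
    have "D t = D (frac t)"
      using D_add[of "of_int \<lfloor>t\<rfloor>" "frac t"] D_int[of "\<lfloor>t\<rfloor>"] by (simp add: frac_def)
    moreover have "\<bar>A (frac t)\<bar> \<le> M" "\<bar>frac t * A 1\<bar> \<le> \<bar>A 1\<bar>"
      using frac_ge_0[of t] frac_lt_1[of t] mult_right_mono[of "frac t" 1 "\<bar>A 1\<bar>"]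
      by (auto intro!: bound simp: abs_mult)
    ultimately show ?thesis by (simp add: D_def)
  qed
  have "D t = 0"
  proof (rule ccontr)
    assume "D t \<noteq> 0"
    then obtain k :: nat where "(M + \<bar>A 1\<bar>) / \<bar>D t\<bar> < real k"
      using reals_Archimedean2 by blast
    then show False
      using bnd[of "real k * t"] \<open>D t \<noteq> 0\<close> unfolding D_nat by (simp add: abs_mult field_simps)
  qed
  then show ?thesis by (simp add: D_def)
qed

lemma quadratic_minus: "quadratic Q \<Longrightarrow> Q (- v) = Q v"
  unfolding quadratic_def by (metis mult_1 power2_minus power_one scaleR_minus1_left)

lemma polar_commute: "quadratic Q \<Longrightarrow> polar Q v w = polar Q w v"
  unfolding polar_def using quadratic_minus[of Q "v - w"] by (simp add: add.commute)

lemma polar_self: "quadratic Q \<Longrightarrow> polar Q v v = Q v"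
proof -
  assume Q: "quadratic Q"
  then have "Q (2 *\<^sub>R v) = 2\<^sup>2 * Q v" "Q (0 *\<^sub>R v) = 0\<^sup>2 * Q v"
    unfolding quadratic_def by blast+
  then show ?thesis by (simp add: polar_def scaleR_2)
qed

lemma polar_bound:
  assumes "quadratic Q"
  shows "\<bar>polar Q v w\<bar> \<le> (Q v + Q w) / 2"
proof -
  have "0 \<le> Q (v + w)" "0 \<le> Q (v - w)" "Q (v + w) + Q (v - w) = 2 * Q v + 2 * Q w"
    using assms by (auto simp: quadratic_def)
  then show ?thesis by (simp add: polar_def)
qed

text \<open>
  Jordan--von Neumann: the parallelogram law alone makes the polarization additive, and
  nonnegativity bounds it along segments, which upgrades additivity to linearity.
\<close>

lemma bilinear_polar:
  fixes Q :: "'v::real_vector \<Rightarrow> real"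
  assumes Q: "quadratic Q"
  shows "bilinear (polar Q)"
proof -
  have par: "Q (v + w) + Q (v - w) = 2 * Q v + 2 * Q w" for v w
    using Q by (simp add: quadratic_def)
  have zero: "polar Q 0 z = 0" for z
    using quadratic_minus[OF Q, of z] by (simp add: polar_def)
  have sum_diff: "polar Q (v + w) z + polar Q (v - w) z = 2 * polar Q v z" for v w z
  proof -
    have "v + w + z = v + z + w" "v + w - z = v - z + w" "v - w + z = v + z - w"
      "v - w - z = v - z - w"
      by (simp_all add: algebra_simps)
    then show ?thesis
      using par[of "v + z" w] par[of "v - z" w] unfolding polar_def by (simp add: field_simps)
  qed
  have double: "polar Q (2 *\<^sub>R v) z = 2 * polar Q v z" for v z
    using sum_diff[of v v z] zero by (simp add: scaleR_2)
  have add: "polar Q (a + b) z = polar Q a z + polar Q b z" for a b z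
  proof -
    have "(1/2::real) *\<^sub>R (a + b) + (1/2::real) *\<^sub>R (a - b) = a"
         "(1/2::real) *\<^sub>R (a + b) - (1/2::real) *\<^sub>R (a - b) = b"
      by (simp_all add: algebra_simps flip: scaleR_add_left)
    then show ?thesis
      using sum_diff[of "(1/2::real) *\<^sub>R (a + b)" "(1/2::real) *\<^sub>R (a - b)" z]
        double[of "(1/2::real) *\<^sub>R (a + b)" z] by simp
  qed
  have scale: "polar Q (t *\<^sub>R v) z = t * polar Q v z" for t v z
  proof -
    have "\<bar>polar Q (s *\<^sub>R v) z\<bar> \<le> (Q v + Q z) / 2" if "\<bar>s\<bar> \<le> 1" for s
    proof -
      have "Q (s *\<^sub>R v) \<le> 1 * Q v"
        using Q that abs_square_le_1[of s] mult_right_mono[of "s\<^sup>2" 1 "Q v"]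
        unfolding quadratic_def by simp
      then show ?thesis using polar_bound[OF Q, of "s *\<^sub>R v" z] by argo
    qed
    then show ?thesis
      using additive_bounded_imp_homogeneous[of "\<lambda>s. polar Q (s *\<^sub>R v) z" "(Q v + Q z) / 2" t]
      by (simp add: add scaleR_add_left)
  qed
  have left: "linear (\<lambda>v. polar Q v z)" for z
    by (rule linearI) (simp_all add: add scale)
  have right: "linear (\<lambda>v. polar Q z v)" for z
    by (rule linearI) (simp_all add: polar_commute[OF Q, of z] add scale)
  show ?thesis
    unfolding bilinear_def using left right by blast
qed

text \<open>
  The Legendre transform of \<open>q\<close> at \<open>2 l\<close>.  If \<open>l\<close> is represented by a vector \<open>v\<close>, that is,
  \<open>l h\<close> is the \<open>q\<close>-inner product of \<open>v\<close> and \<open>h\<close>, then its value is \<open>q v\<close>, attained at \<open>h = v\<close>.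
\<close>

definition dual_form :: "('e \<Rightarrow> real) \<Rightarrow> ('e \<Rightarrow> real) \<Rightarrow> real" where
  "dual_form q l = (SUP h. 2 * l h - q h)"

lemma dual_form_upper: "bdd_above (range (\<lambda>h. 2 * l h - q h)) \<Longrightarrow> 2 * l h - q h \<le> dual_form q l"
  unfolding dual_form_def by (rule cSUP_upper) auto

lemma dual_form_least: "(\<And>h. 2 * l h - q h \<le> M) \<Longrightarrow> dual_form q l \<le> M"
  unfolding dual_form_def by (rule cSUP_least) auto

text \<open>
  One half of the parallelogram law comes from inserting \<open>h + k\<close> and \<open>h - k\<close> into the suprema
  for \<open>v + w\<close> and \<open>v - w\<close>.  The other half is the same inequality for the pair \<open>v + w\<close>,
  \<open>v - w\<close>, since the dual form scales quadratically.
\<close>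

lemma quadratic_dual_form:
  fixes q :: "'e::real_vector \<Rightarrow> real" and L :: "'v::real_vector \<Rightarrow> 'e \<Rightarrow> real"
  assumes q: "quadratic q" and L: "bilinear L"
    and bdd: "\<And>v. bdd_above (range (\<lambda>h. 2 * L v h - q h))"
  shows "quadratic (\<lambda>v. dual_form q (L v))"
proof -
  let ?Q = "\<lambda>v. dual_form q (L v)"
  note L_simps = bilinear_ladd[OF L] bilinear_radd[OF L] bilinear_lsub[OF L] bilinear_rsub[OF L]
    bilinear_lmul[OF L] bilinear_rmul[OF L]
  have q0: "q 0 = 0" and q_nonneg: "q h \<ge> 0" and q_scale: "q (t *\<^sub>R h) = t\<^sup>2 * q h" for h t
    using q scaleR_zero_left unfolding quadratic_def by (metis mult_zero_left zero_power2, auto)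
  have q_par: "q (v + w) + q (v - w) = 2 * q v + 2 * q w" for v w
    using q by (simp add: quadratic_def)
  have nonneg: "0 \<le> ?Q v" for v
    using dual_form_upper[OF bdd[of v], of 0] by (simp add: q0 bilinear_rzero[OF L])
  have scale_le: "?Q (t *\<^sub>R v) \<le> t\<^sup>2 * ?Q v" if "t \<noteq> 0" for t v
  proof (rule dual_form_least)
    fix h
    have "2 * L (t *\<^sub>R v) h - q h = t\<^sup>2 * (2 * L v ((1/t) *\<^sub>R h) - q ((1/t) *\<^sub>R h))"
      using that by (simp add: L_simps q_scale field_simps power2_eq_square)
    also have "\<dots> \<le> t\<^sup>2 * ?Q v"
      by (intro mult_left_mono dual_form_upper bdd) simp
    finally show "2 * L (t *\<^sub>R v) h - q h \<le> t\<^sup>2 * ?Q v" .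
  qed
  have scale: "?Q (t *\<^sub>R v) = t\<^sup>2 * ?Q v" for t v
  proof (cases "t = 0")
    case True
    have "?Q 0 \<le> 0"
      by (rule dual_form_least) (simp add: bilinear_lzero[OF L] q_nonneg)
    then show ?thesis using True nonneg[of 0] by simp
  next
    case False
    have "?Q v \<le> (1/t)\<^sup>2 * ?Q (t *\<^sub>R v)"
      using scale_le[of "1/t" "t *\<^sub>R v"] False by simp
    then show ?thesis using scale_le[OF False, of v] False by (simp add: field_simps)
  qed
  have par_ge: "2 * ?Q v + 2 * ?Q w \<le> ?Q (v + w) + ?Q (v - w)" for v w
  proof -
    let ?R = "?Q (v + w) + ?Q (v - w)"
    have "2 * (2 * L v h - q h) + 2 * (2 * L w k - q k) \<le> ?R" for h k
      using dual_form_upper[OF bdd[of "v + w"], of "h + k"]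
        dual_form_upper[OF bdd[of "v - w"], of "h - k"] q_par[of h k]
      unfolding L_simps by argo
    then have "2 * L v h - q h \<le> ?R / 2 - (2 * L w k - q k)" for h k
      by (simp add: field_simps)
    then have *: "?Q v \<le> ?R / 2 - (2 * L w k - q k)" for k
      by (intro dual_form_least)
    have "2 * L w k - q k \<le> ?R / 2 - ?Q v" for k
      using *[of k] by argo
    then have "?Q w \<le> ?R / 2 - ?Q v"
      by (intro dual_form_least)
    then show ?thesis by argo
  qed
  have "?Q (v + w) + ?Q (v - w) = 2 * ?Q v + 2 * ?Q w" for v w
  proof -
    have "v + w + (v - w) = 2 *\<^sub>R v" "v + w - (v - w) = 2 *\<^sub>R w"
      by (simp_all add: scaleR_2)
    then show ?thesis
      using par_ge[of v w] par_ge[of "v + w" "v - w"] scale[of 2 v] scale[of 2 w] by simp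
  qed
  then show ?thesis using nonneg scale by (simp add: quadratic_def)
qed

section \<open>Operators from bounded bilinear forms\<close>

text \<open>
  The representing vector minimizes \<open>\<parallel>x\<parallel>\<^sup>2 - 2 f x\<close>: the parallelogram law makes minimizing sequences
  Cauchy, and the first variation at the minimum vanishes.
\<close>

lemma riesz_representation:
  fixes f :: "'h::{real_inner,complete_space} \<Rightarrow> real"
  assumes f: "bounded_linear f"
  shows "\<exists>y. \<forall>x. f x = inner y x"
proof -
  interpret f: bounded_linear f by fact
  obtain K where K: "\<And>x. norm (f x) \<le> norm x * K" using f.bounded by blast
  define q where "q x = (norm x)\<^sup>2 - 2 * f x" for x
  have q_lower: "- K\<^sup>2 \<le> q x" for x
  proof -
    have "0 \<le> (norm x - K)\<^sup>2" by simp
    then show ?thesis using K[of x] by (simp add: q_def power2_diff) 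
  qed
  then have bdd: "bdd_below (range q)" by (meson bdd_belowI2)
  define m where "m = Inf (range q)"
  have m: "m \<le> q x" for x unfolding m_def by (rule cINF_lower[OF bdd]) simp
  have mid: "(dist x y)\<^sup>2 \<le> 2 * (q x - m) + 2 * (q y - m)" for x y
  proof -
    have "q ((1/2::real) *\<^sub>R (x + y)) = (q x + q y) / 2 - (dist x y)\<^sup>2 / 4"
      by (simp add: q_def dist_norm power2_norm_eq_inner f.scaleR f.add inner_simps inner_commute
        field_simps)
    then show ?thesis using m[of "(1/2::real) *\<^sub>R (x + y)"] by argo
  qed
  have "\<exists>x. q x < m + 1 / (real k + 1)" for k :: nat
    using cINF_less_iff[OF _ bdd, of "m + 1 / (real k + 1)"] by (auto simp: m_def)
  then obtain x where x: "\<And>k. q (x k) < m + 1 / (real k + 1)" by metis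
  have "Cauchy x"
  proof (rule metric_CauchyI)
    fix e :: real assume "0 < e"
    then obtain N :: nat where N: "8 / e\<^sup>2 < real N" using reals_Archimedean2 by blast
    have "dist (x i) (x j) < e" if "i \<ge> N" "j \<ge> N" for i j
    proof -
      have small: "1 / (real k + 1) < e\<^sup>2 / 8" if "k \<ge> N" for k
      proof -
        have "8 / e\<^sup>2 < real k + 1" using N that by linarith
        then show ?thesis using \<open>0 < e\<close> by (simp add: field_simps)
      qed
      have "(dist (x i) (x j))\<^sup>2 < e\<^sup>2"
        using mid[of "x i" "x j"] x[of i] x[of j] small[OF that(1)] small[OF that(2)] zero_le_power2[of e] by argo
      then show ?thesis using \<open>0 < e\<close> by (simp add: power_less_imp_less_base)
    qed
    then show "\<exists>M. \<forall>i\<ge>M. \<forall>j\<ge>M. dist (x i) (x j) < e" by blast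
  qed
  then obtain y where y: "x \<longlonglongrightarrow> y" using Cauchy_convergent convergent_def by blast
  have "(\<lambda>k. q (x k)) \<longlonglongrightarrow> q y"
    unfolding q_def by (intro tendsto_intros f.tendsto y)
  moreover have "(\<lambda>k. m + 1 / (real k + 1)) \<longlonglongrightarrow> m + 0"
    using LIMSEQ_inverse_real_of_nat by (intro tendsto_add tendsto_const) (simp add: inverse_eq_divide add.commute)
  ultimately have "q y \<le> m + 0"
    by (rule LIMSEQ_le) (use x less_imp_le in blast)
  then have min: "q y \<le> q z" for z using m[of z] by simp
  have "f z = inner y z" for z
  proof (rule ccontr)
    assume ne: "f z \<noteq> inner y z"
    define a where "a = inner y z - f z"
    have quad: "0 \<le> 2 * t * a + t\<^sup>2 * (norm z)\<^sup>2" for t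
    proof -
      have "(norm (y + t *\<^sub>R z))\<^sup>2 = (norm y)\<^sup>2 + 2 * t * inner y z + t\<^sup>2 * (norm z)\<^sup>2"
        unfolding power2_norm_eq_inner
        by (simp add: inner_add_left inner_add_right inner_commute[of z y] power2_eq_square algebra_simps)
      then show ?thesis
        using min[of "y + t *\<^sub>R z"] by (simp add: q_def a_def f.scaleR f.add algebra_simps)
    qed
    have "a \<noteq> 0" using ne by (simp add: a_def)
    \<comment> \<open>Moving from the minimum by \<open>- s * a\<close> along \<open>z\<close> changes \<open>q\<close> by \<open>a\<^sup>2 * s * (s * b - 2)\<close>,
      which is negative for small positive \<open>s\<close>.\<close>
    define b where "b = (norm z)\<^sup>2"
    have "0 \<le> b" by (simp add: b_def)
    define s where "s = 1 / (b + 1)"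
    have "0 < s" "s * b < 1" using \<open>0 \<le> b\<close> by (simp_all add: s_def field_simps)
    have "0 \<le> a\<^sup>2 * (s * (s * b - 2))"
      using quad[of "- s * a"] by (simp add: b_def power2_eq_square algebra_simps)
    moreover have "s * (s * b - 2) < 0"
      using \<open>0 < s\<close> \<open>s * b < 1\<close> by (intro mult_pos_neg) auto
    ultimately show False
      using \<open>a \<noteq> 0\<close> mult_pos_neg[of "a\<^sup>2"] by (meson not_less zero_less_power2)
  qed
  then show ?thesis by blast
qed

lemma bilinear_form_operator:
  fixes C :: "'h::{real_inner,complete_space} \<Rightarrow> 'h \<Rightarrow> real"
  assumes C: "bilinear C" and bound: "\<And>u v. \<bar>C u v\<bar> \<le> M * ((norm u)\<^sup>2 + (norm v)\<^sup>2)"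
  shows "\<exists>R :: 'h \<Rightarrow>\<^sub>L 'h. \<forall>u v. inner (blinfun_apply R v) u = C u v"
proof -
  have norm_bound: "\<bar>C u v\<bar> \<le> 2 * M * norm u * norm v" for u v
  proof (cases "u = 0 \<or> v = 0")
    case True
    then show ?thesis using bilinear_lzero[OF C] bilinear_rzero[OF C] by auto
  next
    case False
    have "C u v = norm u * norm v * C (sgn u) (sgn v)"
      using False by (simp add: sgn_div_norm bilinear_lmul[OF C] bilinear_rmul[OF C] field_simps)
    moreover have "\<bar>C (sgn u) (sgn v)\<bar> \<le> M * 2"
      using bound[of "sgn u" "sgn v"] False by (simp add: norm_sgn)
    ultimately show ?thesis
      using mult_left_mono[of "\<bar>C (sgn u) (sgn v)\<bar>" "M * 2" "norm u * norm v"]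
      by (simp add: abs_mult mult_ac)
  qed
  have "bounded_linear (\<lambda>u. C u v)" for v
    using norm_bound[of _ v]
    by (intro bounded_linear_intro[where K = "2 * M * norm v"])
      (auto simp: bilinear_ladd[OF C] bilinear_lmul[OF C] mult_ac)
  then have "\<exists>y. \<forall>u. C u v = inner y u" for v by (rule riesz_representation)
  then obtain R where R: "\<And>u v. C u v = inner (R v) u" by metis
  have eqI: "a = b" if "\<And>u. inner a u = inner b u" for a b :: 'h
    using that vector_eq_rdot by blast
  have "bounded_linear R"
  proof (rule bounded_linear_intro)
    show "R (v + w) = R v + R w" for v w
      by (rule eqI) (simp add: inner_add_left bilinear_radd[OF C] flip: R)
    show "R (t *\<^sub>R v) = t *\<^sub>R R v" for t v
      by (rule eqI) (simp add: bilinear_rmul[OF C] flip: R)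
    show "norm (R v) \<le> norm v * (2 * M)" for v
    proof (cases "R v = 0")
      case True
      have "0 \<le> 2 * M * norm v * norm v" using norm_bound[of v v] by (smt (verit))
      then have "0 \<le> M \<or> v = 0" by (auto simp: zero_le_mult_iff)
      then show ?thesis using True by auto
    next
      case False
      have "norm (R v) * norm (R v) \<le> 2 * M * norm (R v) * norm v"
        using norm_bound[of "R v" v] by (simp add: R flip: power2_norm_eq_inner power2_eq_square)
      then show ?thesis using False by (simp add: mult_ac)
    qed
  qed
  then have "\<forall>u v. inner (blinfun_apply (Blinfun R) v) u = C u v"
    by (simp add: bounded_linear_Blinfun_apply flip: R)
  then show ?thesis by blast
qed


section \<open>Operator kernels and central coupling\<close>

definition kernel_form :: "('i \<Rightarrow> 'i \<Rightarrow> 'h::real_inner \<Rightarrow>\<^sub>L 'h) \<Rightarrow> 'i set \<Rightarrow> ('i \<Rightarrow> 'h) \<Rightarrow> real" where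
  "kernel_form K B h = (\<Sum>x\<in>B. \<Sum>y\<in>B. inner (K x y (h y)) (h x))"

text \<open>
  For complex linear entries, symmetry of the real parts is self-adjointness of the operator matrix.
\<close>

definition psd_kernel_on :: "('i \<Rightarrow> 'i \<Rightarrow> 'h::real_inner \<Rightarrow>\<^sub>L 'h) \<Rightarrow> 'i set \<Rightarrow> bool" where
  "psd_kernel_on K Z \<longleftrightarrow>
     (\<forall>x\<in>Z. \<forall>y\<in>Z. \<forall>u v. inner (K x y v) u = inner (K y x u) v) \<and> (\<forall>h. 0 \<le> kernel_form K Z h)"

definition cross_form ::
    "('i \<Rightarrow> 'i \<Rightarrow> 'h::real_inner \<Rightarrow>\<^sub>L 'h) \<Rightarrow> 'i set \<Rightarrow> 'i \<Rightarrow> 'h \<Rightarrow> ('i \<Rightarrow> 'h) \<Rightarrow> real" where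
  "cross_form K B x u h = (\<Sum>b\<in>B. inner (K x b (h b)) u)"

definition coupling ::
    "('i \<Rightarrow> 'i \<Rightarrow> 'h::real_inner \<Rightarrow>\<^sub>L 'h) \<Rightarrow> 'i set \<Rightarrow> 'i set \<Rightarrow> ('i \<Rightarrow> 'h) \<Rightarrow> ('i \<Rightarrow> 'h) \<Rightarrow> real" where
  "coupling K X B f h = (\<Sum>x\<in>X. cross_form K B x (f x) h)"

text \<open>
  The polarization of the dual form, written out for the functionals that the points \<open>x\<close>, \<open>y\<close> with vectors
  \<open>u\<close>, \<open>v\<close> induce on \<open>B\<close>: the inner product of the projections of these two vectors to the span of \<open>B\<close>.
  It mentions no further points, so it can be compared along maps that preserve the kernel.
\<close>

definition central_form ::
    "('i \<Rightarrow> 'i \<Rightarrow> 'h::real_inner \<Rightarrow>\<^sub>L 'h) \<Rightarrow> 'i set \<Rightarrow> 'i \<Rightarrow> 'h \<Rightarrow> 'i \<Rightarrow> 'h \<Rightarrow> real" where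
  "central_form K B x u y v =
     (dual_form (kernel_form K B) (\<lambda>h. cross_form K B x u h + cross_form K B y v h) -
      dual_form (kernel_form K B) (\<lambda>h. cross_form K B x u h - cross_form K B y v h)) / 4"

definition single :: "'i \<Rightarrow> 'h::real_vector \<Rightarrow> 'i \<Rightarrow> 'h" where
  "single x u = (\<lambda>y. if y = x then u else 0)"

lemma kernel_form_cong:
  "(\<And>x. x \<in> B \<Longrightarrow> f x = h x) \<Longrightarrow> kernel_form K B f = kernel_form K B h"
  by (simp add: kernel_form_def)

lemma kernel_form_mono_neutral:
  assumes "finite B" "A \<subseteq> B" "\<And>x. x \<in> B - A \<Longrightarrow> h x = 0"
  shows "kernel_form K B h = kernel_form K A h"
proof -
  have "(\<Sum>y\<in>B. inner (K x y (h y)) (h x)) = (\<Sum>y\<in>A. inner (K x y (h y)) (h x))" for x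
    using assms by (intro sum.mono_neutral_right) auto
  moreover have "(\<Sum>x\<in>B. \<Sum>y\<in>A. inner (K x y (h y)) (h x)) = kernel_form K A h"
    unfolding kernel_form_def using assms by (intro sum.mono_neutral_right) auto
  ultimately show ?thesis by (simp add: kernel_form_def)
qed

lemma psd_kernel_on_subset:
  assumes "psd_kernel_on K Z" "finite Z" "A \<subseteq> Z"
  shows "psd_kernel_on K A"
proof -
  have "0 \<le> kernel_form K A h" for h
  proof -
    let ?g = "\<lambda>x. if x \<in> A then h x else 0"
    have "kernel_form K A h = kernel_form K A ?g" by (rule kernel_form_cong) simp
    also have "\<dots> = kernel_form K Z ?g"
      using assms by (intro kernel_form_mono_neutral[symmetric]) auto
    finally show ?thesis using assms by (simp add: psd_kernel_on_def)
  qed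
  moreover have "inner (K x y v) u = inner (K y x u) v" if "x \<in> A" "y \<in> A" for x y u v
    using assms that by (meson psd_kernel_on_def subsetD)
  ultimately show ?thesis by (simp add: psd_kernel_on_def)
qed

lemma quadratic_kernel_form:
  assumes "psd_kernel_on K B"
  shows "quadratic (kernel_form K B)"
  unfolding quadratic_def
proof (intro conjI allI)
  show "0 \<le> kernel_form K B v" for v
    using assms by (simp add: psd_kernel_on_def)
  show "kernel_form K B (t *\<^sub>R v) = t\<^sup>2 * kernel_form K B v" for t v
    by (simp add: kernel_form_def scaleR_fun_def blinfun.scaleR_right sum_distrib_left
      power2_eq_square mult_ac)
  show "kernel_form K B (v + w) + kernel_form K B (v - w) =
      2 * kernel_form K B v + 2 * kernel_form K B w" for v w
    by (simp add: kernel_form_def blinfun.add_right blinfun.diff_right inner_add_left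
      inner_add_right inner_diff_left inner_diff_right sum_distrib_left algebra_simps
      flip: sum.distrib)
qed

lemma kernel_form_Un:
  fixes K :: "'i \<Rightarrow> 'i \<Rightarrow> 'h::real_inner \<Rightarrow>\<^sub>L 'h"
  assumes "finite B" "finite W" "B \<inter> W = {}"
    and sym: "\<And>x y u v. x \<in> B \<Longrightarrow> y \<in> W \<Longrightarrow> inner (K x y v) u = inner (K y x u) v"
  shows "kernel_form K (B \<union> W) h = kernel_form K B h + kernel_form K W h + 2 * coupling K W B h h"
proof -
  let ?t = "\<lambda>x y. inner (K x y (h y)) (h x)"
  have "(\<Sum>x\<in>B. \<Sum>y\<in>W. ?t x y) = (\<Sum>x\<in>B. \<Sum>y\<in>W. ?t y x)"
    by (intro sum.cong refl sym)
  also have "\<dots> = (\<Sum>y\<in>W. \<Sum>x\<in>B. ?t y x)" by (rule sum.swap)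
  finally show ?thesis
    using assms(1-3)
    by (simp add: kernel_form_def coupling_def cross_form_def sum.union_disjoint sum.distrib)
qed

lemma bilinear_coupling: "bilinear (coupling K X B)"
proof -
  have "linear (coupling K X B f)" for f
    by (rule linearI)
      (simp_all add: coupling_def cross_form_def blinfun.add_right inner_add_left sum.distrib
        scaleR_fun_def blinfun.scaleR_right sum_distrib_left)
  moreover have "linear (\<lambda>f. coupling K X B f h)" for h
    by (rule linearI)
      (simp_all add: coupling_def cross_form_def inner_add_right sum.distrib
        scaleR_fun_def sum_distrib_left)
  ultimately show ?thesis by (simp add: bilinear_def)
qed

lemma coupling_single:
  assumes "finite X" "x \<in> X"
  shows "coupling K X B (single x u) h = cross_form K B x u h"
proof -
  have "coupling K X B (single x u) h = (\<Sum>y\<in>X. if y = x then cross_form K B x u h else 0)"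
    unfolding coupling_def by (rule sum.cong) (auto simp: single_def cross_form_def)
  then show ?thesis using assms by simp
qed

text \<open>
  Positivity at the vector with entries \<open>f\<close> on \<open>W\<close> and \<open>- h\<close> on \<open>B\<close>.  Taking the supremum over
  \<open>h\<close>, it says that projecting to \<open>B\<close> does not increase lengths.
\<close>

lemma coupling_le_kernel_form:
  assumes "finite B" "finite W" "B \<inter> W = {}" "psd_kernel_on K (B \<union> W)"
  shows "2 * coupling K W B f h - kernel_form K B h \<le> kernel_form K W f"
proof -
  let ?g = "\<lambda>x. if x \<in> W then f x else - h x"
  have "0 \<le> kernel_form K (B \<union> W) ?g"
    using assms(4) by (simp add: psd_kernel_on_def)
  also have "\<dots> = kernel_form K B ?g + kernel_form K W ?g + 2 * coupling K W B ?g ?g"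
    using assms by (intro kernel_form_Un) (auto simp: psd_kernel_on_def)
  also have "kernel_form K B ?g = kernel_form K B (- h)"
    using assms(3) by (intro kernel_form_cong) auto
  also have "kernel_form K B (- h) = kernel_form K B h"
    by (simp add: kernel_form_def blinfun.minus_right)
  also have "kernel_form K W ?g = kernel_form K W f"
    by (intro kernel_form_cong) auto
  also have "coupling K W B ?g ?g = (\<Sum>x\<in>W. \<Sum>b\<in>B. - inner (K x b (h b)) (f x))"
    unfolding coupling_def cross_form_def using assms(3)
    by (intro sum.cong refl) (auto simp: blinfun.minus_right)
  also have "\<dots> = - coupling K W B f h"
    by (simp add: coupling_def cross_form_def sum_negf)
  finally show ?thesis by simp
qed

text \<open>
  Each point \<open>x\<close> of \<open>X\<close> is only known to be compatible with \<open>B\<close> by itself, so \<open>kernel_form K B h\<close> is shared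
  equally among the points.  The factor \<open>N = card X\<close> by which \<open>f\<close> is rescaled pays for that.
\<close>

lemma bdd_above_coupling:
  assumes "finite B" "finite X" "B \<inter> X = {}" "psd_kernel_on K B"
    and psd: "\<And>x. x \<in> X \<Longrightarrow> psd_kernel_on K (insert x B)"
  shows "bdd_above (range (\<lambda>h. 2 * coupling K X B f h - kernel_form K B h))"
proof (cases "X = {}")
  case True
  have "0 \<le> kernel_form K B h" for h using assms(4) by (simp add: psd_kernel_on_def)
  then show ?thesis using True by (intro bdd_aboveI2[of _ _ 0]) (simp add: coupling_def)
next
  case False
  define N where "N = real (card X)"
  have "N > 0" using False assms(2) by (simp add: N_def card_gt_0_iff)
  let ?M = "\<Sum>x\<in>X. kernel_form K {x} (\<lambda>y. N *\<^sub>R f y)"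
  have "2 * coupling K X B f h - kernel_form K B h \<le> ?M / N" for h
  proof -
    have "2 * (N * cross_form K B x (f x) h) - kernel_form K B h
        \<le> kernel_form K {x} (\<lambda>y. N *\<^sub>R f y)" if "x \<in> X" for x
    proof -
      have "B \<inter> {x} = {}" "psd_kernel_on K (B \<union> {x})"
        using that assms(3) psd[OF that] by auto
      from coupling_le_kernel_form[OF assms(1) _ this, of "\<lambda>y. N *\<^sub>R f y" h] show ?thesis
        by (simp add: coupling_def cross_form_def sum_distrib_left)
    qed
    then have "(\<Sum>x\<in>X. 2 * (N * cross_form K B x (f x) h) - kernel_form K B h) \<le> ?M"
      by (rule sum_mono)
    also have "(\<Sum>x\<in>X. 2 * (N * cross_form K B x (f x) h) - kernel_form K B h) =
        N * (2 * coupling K X B f h - kernel_form K B h)"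
      by (simp add: sum_subtractf coupling_def sum_distrib_left N_def algebra_simps)
    finally show ?thesis using \<open>N > 0\<close> by (simp add: field_simps)
  qed
  then show ?thesis by (rule bdd_aboveI2)
qed

lemma central_form_eq_polar:
  assumes "finite X" "x \<in> X" "y \<in> X"
  shows "central_form K B x u y v =
    polar (\<lambda>f. dual_form (kernel_form K B) (coupling K X B f)) (single x u) (single y v)"
proof -
  note L = bilinear_coupling[of K X B]
  have "coupling K X B (single x u + single y v) = (\<lambda>h. cross_form K B x u h + cross_form K B y v h)"
    "coupling K X B (single x u - single y v) = (\<lambda>h. cross_form K B x u h - cross_form K B y v h)"
    using assms by (auto simp: bilinear_ladd[OF L] bilinear_lsub[OF L] coupling_single)
  then show ?thesis by (simp add: polar_def central_form_def)
qed

text \<open>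
  Amalgamation over a separator.  The matrix of central forms is a Gram matrix of projections; the
  difference \<open>D\<close> between the kernel and it on \<open>X\<close> vanishes between different classes and is
  positive semidefinite on each class.  Hence the kernel dominates the dual form on \<open>X\<close>,
  and the dual form is the smallest diagonal block that keeps \<open>B \<union> X\<close> positive semidefinite.
\<close>

theorem psd_kernel_on_amalgam:
  fixes K :: "'i \<Rightarrow> 'i \<Rightarrow> 'h::real_inner \<Rightarrow>\<^sub>L 'h" and cls :: "'i \<Rightarrow> 'c"
  assumes fin: "finite B" "finite X" and disj: "B \<inter> X = {}"
    and sym: "\<And>x y u v. x \<in> B \<union> X \<Longrightarrow> y \<in> B \<union> X \<Longrightarrow> inner (K x y v) u = inner (K y x u) v"
    and B: "psd_kernel_on K B"
    and psd: "\<And>c. psd_kernel_on K (B \<union> {x\<in>X. cls x = c})"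
    and central: "\<And>x y u v. x \<in> X \<Longrightarrow> y \<in> X \<Longrightarrow> cls x \<noteq> cls y \<Longrightarrow>
      inner (K x y v) u = central_form K B x u y v"
  shows "psd_kernel_on K (B \<union> X)"
proof -
  let ?L = "coupling K X B"
  define Q where "Q f = dual_form (kernel_form K B) (?L f)" for f
  have bdd: "bdd_above (range (\<lambda>h. 2 * ?L f h - kernel_form K B h))" for f
  proof (rule bdd_above_coupling[OF fin disj B])
    fix x assume "x \<in> X"
    then show "psd_kernel_on K (insert x B)"
      by (intro psd_kernel_on_subset[OF psd[of "cls x"]]) (auto simp: fin)
  qed
  have Q: "quadratic Q"
    unfolding Q_def by (rule quadratic_dual_form[OF quadratic_kernel_form[OF B] bilinear_coupling bdd])
  define C where "C h x y = polar Q (single x (h x)) (single y (h y))" for h :: "'i \<Rightarrow> 'h" and x y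
  have expand: "Q (\<Sum>x\<in>W. single x (h x)) = (\<Sum>x\<in>W. \<Sum>y\<in>W. C h x y)" if "finite W" for W h
    using bilinear_sum[OF bilinear_polar[OF Q], of "\<lambda>x. single x (h x)" W "\<lambda>x. single x (h x)" W]
    by (simp add: polar_self[OF Q] C_def sum.cartesian_product)
  have single_sum: "(\<Sum>x\<in>W. single x (h x)) y = (if y \<in> W then h y else 0)" if "finite W"
    for W h y
    using that by (simp add: sum_fun_apply single_def)
  have "0 \<le> kernel_form K (B \<union> X) h" for h
  proof -
    define D where "D x y = inner (K x y (h y)) (h x) - C h x y" for x y
    \<comment> \<open>\<open>D\<close> holds the entries at \<open>h\<close> of the Schur complement of the kernel with respect to \<open>B\<close>.\<close>
    have D_zero: "D x y = 0" if "x \<in> X" "y \<in> X" "cls x \<noteq> cls y" for x y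
      using central[OF that] central_form_eq_polar[OF fin(2) that(1,2)]
      by (simp add: D_def C_def Q_def[abs_def])
    have class_nonneg: "0 \<le> (\<Sum>x\<in>W. \<Sum>y\<in>W. D x y)" if "W = {x\<in>X. cls x = c}" for W c
    proof -
      have W: "finite W" "W \<subseteq> X" "B \<inter> W = {}" "psd_kernel_on K (B \<union> W)"
        using that fin disj psd[of c] by auto
      have "Q (\<Sum>x\<in>W. single x (h x)) \<le> kernel_form K W h"
        unfolding Q_def
      proof (rule dual_form_least)
        fix k
        have "?L (\<Sum>x\<in>W. single x (h x)) k = coupling K W B h k"
          unfolding coupling_def
          using W(2) by (intro sum.mono_neutral_cong_right)
            (auto simp: fin single_sum[OF W(1)] cross_form_def)
        then show "2 * ?L (\<Sum>x\<in>W. single x (h x)) k - kernel_form K B k \<le> kernel_form K W h"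
          using coupling_le_kernel_form[OF fin(1) W(1,3,4)] by simp
      qed
      then show ?thesis
        unfolding expand[OF W(1)] by (simp add: D_def sum_subtractf kernel_form_def)
    qed
    have "(\<Sum>x\<in>X. \<Sum>y\<in>X. D x y) = (\<Sum>x\<in>X. \<Sum>y | y \<in> X \<and> cls y = cls x. D x y)"
    proof (rule sum.cong[OF refl])
      fix x assume "x \<in> X"
      then show "(\<Sum>y\<in>X. D x y) = (\<Sum>y | y \<in> X \<and> cls y = cls x. D x y)"
        using fin(2) by (intro sum.mono_neutral_right) (auto intro!: D_zero)
    qed
    also have "\<dots> = (\<Sum>c\<in>cls ` X. \<Sum>x | x \<in> X \<and> cls x = c. \<Sum>y | y \<in> X \<and> cls y = cls x. D x y)"
      by (rule sum.image_gen[OF fin(2)])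
    also have "\<dots> = (\<Sum>c\<in>cls ` X. \<Sum>x | x \<in> X \<and> cls x = c. \<Sum>y | y \<in> X \<and> cls y = c. D x y)"
      by simp
    also have "\<dots> \<ge> 0"
      by (intro sum_nonneg class_nonneg[OF refl])
    finally have "Q (\<Sum>x\<in>X. single x (h x)) \<le> kernel_form K X h"
      unfolding expand[OF fin(2)] by (simp add: D_def sum_subtractf kernel_form_def)
    moreover have "- 2 * coupling K X B h h - kernel_form K B h \<le> Q (\<Sum>x\<in>X. single x (h x))"
    proof -
      have "?L (\<Sum>x\<in>X. single x (h x)) (- h) = - coupling K X B h h"
        unfolding coupling_def cross_form_def
        by (simp add: single_sum[OF fin(2)] blinfun.minus_right sum_negf)
      then show ?thesis
        using dual_form_upper[OF bdd, of "\<Sum>x\<in>X. single x (h x)" "- h"]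
          quadratic_minus[OF quadratic_kernel_form[OF B], of h]
        by (simp add: Q_def)
    qed
    moreover have "kernel_form K (B \<union> X) h = kernel_form K B h + kernel_form K X h + 2 * coupling K X B h h"
      using fin disj sym by (intro kernel_form_Un) auto
    ultimately show ?thesis by simp
  qed
  then show ?thesis using sym by (simp add: psd_kernel_on_def)
qed

text \<open>
  The bound for Riesz representation comes from the diagonal entries, because projections shorten vectors.
\<close>

lemma central_operator_exists:
  fixes K :: "'i \<Rightarrow> 'i \<Rightarrow> 'h::{real_inner,complete_space} \<Rightarrow>\<^sub>L 'h"
  assumes fin: "finite B" and notin: "x \<notin> B" "y \<notin> B"
    and psd: "psd_kernel_on K (insert x B)" "psd_kernel_on K (insert y B)"
  shows "\<exists>R :: 'h \<Rightarrow>\<^sub>L 'h. \<forall>u v. inner (R v) u = central_form K B x u y v"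
proof -
  let ?X = "{x, y}"
  define Q where "Q f = dual_form (kernel_form K B) (coupling K ?X B f)" for f
  have B: "psd_kernel_on K B"
    by (rule psd_kernel_on_subset[OF psd(1)]) (use fin in auto)
  have "quadratic Q"
    unfolding Q_def using fin notin psd
    by (intro quadratic_dual_form quadratic_kernel_form bilinear_coupling bdd_above_coupling B) auto
  note C = bilinear_polar[OF this] and Q = this
  have central: "central_form K B x u y v = polar Q (single x u) (single y v)" for u v
    using central_form_eq_polar[of ?X x y] by (simp add: Q_def[abs_def])
  have single_add: "single z (u + v) = single z u + single z v"
    and single_scale: "single z (t *\<^sub>R u) = t *\<^sub>R single z u" for z :: 'i and u v :: 'h and t
    by (auto simp: single_def scaleR_fun_def)
  have Q_single: "Q (single z u) \<le> norm (K z z) * (norm u)\<^sup>2"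
    if z: "z \<in> ?X" and psd_z: "psd_kernel_on K (insert z B)" and "z \<notin> B" for z u
    unfolding Q_def
  proof (rule dual_form_least)
    fix h
    have "2 * coupling K ?X B (single z u) h - kernel_form K B h \<le> kernel_form K {z} (single z u)"
      using coupling_le_kernel_form[of B "{z}" K "single z u" h] fin psd_z \<open>z \<notin> B\<close> z
      by (simp add: coupling_single[of _ z])
    also have "\<dots> = inner (K z z u) u" by (simp add: kernel_form_def single_def)
    also have "\<dots> \<le> norm (K z z u) * norm u" by (rule norm_cauchy_schwarz)
    also have "\<dots> \<le> norm (K z z) * norm u * norm u"
      by (intro mult_right_mono norm_blinfun) auto
    finally show "2 * coupling K ?X B (single z u) h - kernel_form K B h \<le> norm (K z z) * (norm u)\<^sup>2"
      by (simp add: power2_eq_square mult_ac)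
  qed
  let ?M = "norm (K x x) + norm (K y y)"
  have "\<bar>central_form K B x u y v\<bar> \<le> ?M * ((norm u)\<^sup>2 + (norm v)\<^sup>2)" for u v
  proof -
    have "\<bar>central_form K B x u y v\<bar> \<le> (Q (single x u) + Q (single y v)) / 2"
      unfolding central by (rule polar_bound[OF Q])
    also have "\<dots> \<le> norm (K x x) * (norm u)\<^sup>2 + norm (K y y) * (norm v)\<^sup>2"
      using Q_single[of x u] Q_single[of y v] psd notin
        mult_nonneg_nonneg[of "norm (K x x)" "(norm u)\<^sup>2"]
        mult_nonneg_nonneg[of "norm (K y y)" "(norm v)\<^sup>2"]
      by (simp del: mult_nonneg_nonneg)
    also have "\<dots> \<le> ?M * ((norm u)\<^sup>2 + (norm v)\<^sup>2)"
      by (simp add: algebra_simps add_nonneg_nonneg)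
    finally show ?thesis .
  qed
  moreover have "bilinear (\<lambda>u v. central_form K B x u y v)"
    unfolding bilinear_def
  proof (intro conjI allI)
    show "linear (\<lambda>v. central_form K B x u y v)" for u
      by (rule linearI)
        (simp_all add: central single_add single_scale bilinear_radd[OF C] bilinear_rmul[OF C])
    show "linear (\<lambda>u. central_form K B x u y v)" for v
      by (rule linearI)
        (simp_all add: central single_add single_scale bilinear_ladd[OF C] bilinear_lmul[OF C])
  qed
  ultimately show ?thesis by (intro bilinear_form_operator)
qed

lemma central_form_commute:
  assumes fin: "finite B" and notin: "x \<notin> B" "y \<notin> B"
    and psd: "psd_kernel_on K (insert x B)" "psd_kernel_on K (insert y B)"
  shows "central_form K B x u y v = central_form K B y v x u"
proof -
  have B: "psd_kernel_on K B"
    by (rule psd_kernel_on_subset[OF psd(1)]) (use fin in auto)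
  have "quadratic (\<lambda>f. dual_form (kernel_form K B) (coupling K {x, y} B f))"
    using fin notin psd
    by (intro quadratic_dual_form quadratic_kernel_form bilinear_coupling bdd_above_coupling B) auto
  then show ?thesis
    using central_form_eq_polar[of "{x, y}" x y K B u v]
      central_form_eq_polar[of "{x, y}" y x K B v u]
    by (simp add: polar_commute[of _ "single x u" "single y v"])
qed

lemma dual_form_reindex:
  assumes "surj g"
  shows "dual_form (\<lambda>h. q (g h)) (\<lambda>h. l (g h)) = dual_form q l"
proof -
  have "range (\<lambda>h. 2 * l (g h) - q (g h)) = (\<lambda>h. 2 * l h - q h) ` range g"
    by (simp add: image_image)
  then show ?thesis using assms by (simp add: dual_form_def)
qed

text \<open>
  The central form only sees the kernel on \<open>B\<close> and between \<open>B\<close> and the two points, so any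
  relabelling that preserves these entries preserves it.
\<close>

lemma central_form_transport:
  assumes inj: "inj_on g B"
    and K: "\<And>b c. b \<in> B \<Longrightarrow> c \<in> B \<Longrightarrow> K' (g b) (g c) = K b c"
      "\<And>b. b \<in> B \<Longrightarrow> K' x' (g b) = K x b" "\<And>b. b \<in> B \<Longrightarrow> K' y' (g b) = K y b"
  shows "central_form K' (g ` B) x' u y' v = central_form K B x u y v"
proof -
  have q: "kernel_form K' (g ` B) h = kernel_form K B (\<lambda>b. h (g b))" for h
    by (simp add: kernel_form_def sum.reindex[OF inj] K)
  have l: "cross_form K' (g ` B) x' u h = cross_form K B x u (\<lambda>b. h (g b))"
     "cross_form K' (g ` B) y' u h = cross_form K B y u (\<lambda>b. h (g b))" for u h
    by (simp_all add: cross_form_def sum.reindex[OF inj] K)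
  have "dual_form (kernel_form K' (g ` B)) (\<lambda>h. cross_form K' (g ` B) x' u h + t * cross_form K' (g ` B) y' v h)
    = dual_form (kernel_form K B) (\<lambda>h. cross_form K B x u h + t * cross_form K B y v h)" for t
  proof -
    define F where "F h = 2 * (cross_form K B x u h + t * cross_form K B y v h) - kernel_form K B h" for h
    have pull_back: "F h = F (\<lambda>b. h (inv_into B g (g b)))" for h
      unfolding F_def kernel_form_def cross_form_def by (simp add: inj cong: sum.cong)
    have "range (\<lambda>h. F (\<lambda>b. h (g b))) = range F"
    proof
      show "range F \<subseteq> range (\<lambda>h. F (\<lambda>b. h (g b)))"
      proof (rule image_subsetI)
        fix h
        show "F h \<in> range (\<lambda>h. F (\<lambda>b. h (g b)))"
          unfolding pull_back[of h] by (rule range_eqI[of _ _ "\<lambda>c. h (inv_into B g c)"]) (rule refl)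
      qed
    qed auto
    then show ?thesis by (simp add: dual_form_def q l F_def)
  qed
  from this[of 1] this[of "-1"] show ?thesis by (simp add: central_form_def)
qed


section \<open>Central completion over a tree metric\<close>

definition separator :: "'i set \<Rightarrow> ('i \<Rightarrow> 'i \<Rightarrow> nat) \<Rightarrow> nat \<Rightarrow> 'i \<Rightarrow> 'i \<Rightarrow> 'i set" where
  "separator U d n x y = {z \<in> U. d z x \<le> n \<and> d z y \<le> n}"

text \<open>
  The four-point condition characterizes the metrics that embed into trees.  It is all that the completion
  uses about the Cayley tree.
\<close>

locale tree_metric =
  fixes U :: "'i set" and d :: "'i \<Rightarrow> 'i \<Rightarrow> nat"
  assumes d_refl: "x \<in> U \<Longrightarrow> d x x = 0"
    and d_commute: "x \<in> U \<Longrightarrow> y \<in> U \<Longrightarrow> d x y = d y x"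
    and four_point: "x \<in> U \<Longrightarrow> y \<in> U \<Longrightarrow> z \<in> U \<Longrightarrow> w \<in> U \<Longrightarrow>
      d z w + d x y \<le> max (d z x + d w y) (d z y + d w x)"
begin

lemma separator_commute: "separator U d n x y = separator U d n y x"
  by (auto simp: separator_def)

lemma dist_separator_le:
  assumes xy: "x \<in> U" "y \<in> U" "d x y = Suc n"
    and a: "a \<in> separator U d n x y"
    and b: "b \<in> U" "d b x \<le> Suc n" "d b y \<le> Suc n"
  shows "d a b \<le> n"
  using four_point[of x y a b] assms by (auto simp: separator_def max_def split: if_splits)

lemma separator_subset:
  assumes xy: "x \<in> U" "y \<in> U" "d x y = Suc n"
    and zw: "z \<in> U" "w \<in> U" "d z w = Suc n"
    and close: "d x z \<le> Suc n" "d x w \<le> Suc n" "d y z \<le> Suc n" "d y w \<le> Suc n"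
  shows "separator U d n z w \<subseteq> separator U d n x y"
proof
  fix a assume a: "a \<in> separator U d n z w"
  then have "a \<in> U" by (simp add: separator_def)
  moreover have "d a x \<le> n" "d a y \<le> n"
    using dist_separator_le[OF zw a] close xy by auto
  ultimately show "a \<in> separator U d n x y" by (simp add: separator_def)
qed

text \<open>
  In a tree, both separators are the ball of radius \<open>(n - 1) / 2\<close> around the common midpoint
  of the two pairs.
\<close>

lemma separator_eq:
  assumes "x \<in> U" "y \<in> U" "d x y = Suc n" "z \<in> U" "w \<in> U" "d z w = Suc n"
    and "d x z \<le> Suc n" "d x w \<le> Suc n" "d y z \<le> Suc n" "d y w \<le> Suc n"
  shows "separator U d n z w = separator U d n x y"
  using separator_subset[of x y n z w] separator_subset[of z w n x y] assms
  by (simp add: d_commute subset_antisym)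

lemma psd_insert_separator:
  assumes small: "\<And>Z. finite Z \<Longrightarrow> Z \<subseteq> U \<Longrightarrow> \<forall>x\<in>Z. \<forall>y\<in>Z. d x y \<le> n \<Longrightarrow> psd_kernel_on K Z"
    and fin: "finite (separator U d n x y)"
    and xy: "x \<in> U" "y \<in> U" "d x y = Suc n" and z: "z \<in> {x, y}"
  shows "z \<notin> separator U d n x y" "psd_kernel_on K (insert z (separator U d n x y))"
proof -
  show "z \<notin> separator U d n x y"
    using z xy d_commute[of x y] by (auto simp: separator_def)
  have "d a b \<le> n" if ab: "a \<in> separator U d n x y" "b \<in> insert z (separator U d n x y)" for a b
  proof (rule dist_separator_le[OF xy ab(1)])
    show "b \<in> U" "d b x \<le> Suc n" "d b y \<le> Suc n"
      using ab(2) z xy by (auto simp: separator_def d_refl d_commute[of y x])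
  qed
  moreover have "insert z (separator U d n x y) \<subseteq> U"
    using z xy by (auto simp: separator_def)
  ultimately show "psd_kernel_on K (insert z (separator U d n x y))"
    using fin by (intro small) (auto simp: d_refl, metis d_commute insert_subset subsetD)
qed

text \<open>
  A set of diameter exactly \<open>n + 1\<close> splits into the separator \<open>B\<close> of an extremal pair and the
  remaining points \<open>X\<close>.  A point of \<open>X\<close> within distance \<open>n\<close> of both ends of an extremal pair would lie
  in the separator of that pair, which is \<open>B\<close> again.  So being at distance at most \<open>n\<close> is transitive on \<open>X\<close>, and its
  classes are the branches of the tree at \<open>B\<close>, to which \<open>psd_kernel_on_amalgam\<close> applies.
\<close>

theorem psd_kernel_on_central_completion:
  fixes K :: "'i \<Rightarrow> 'i \<Rightarrow> 'h::real_inner \<Rightarrow>\<^sub>L 'h"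
  assumes small: "\<And>Z. finite Z \<Longrightarrow> Z \<subseteq> U \<Longrightarrow> \<forall>x\<in>Z. \<forall>y\<in>Z. d x y \<le> n \<Longrightarrow> psd_kernel_on K Z"
    and fin: "\<And>x y. x \<in> U \<Longrightarrow> y \<in> U \<Longrightarrow> finite (separator U d n x y)"
    and central: "\<And>x y u v. x \<in> U \<Longrightarrow> y \<in> U \<Longrightarrow> d x y = Suc n \<Longrightarrow>
      inner (K x y v) u = central_form K (separator U d n x y) x u y v"
    and Z: "finite Z" "Z \<subseteq> U" "\<forall>x\<in>Z. \<forall>y\<in>Z. d x y \<le> Suc n"
  shows "psd_kernel_on K Z"
proof (cases "\<forall>x\<in>Z. \<forall>y\<in>Z. d x y \<le> n")
  case True
  then show ?thesis using small Z by blast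
next
  case False
  then obtain x0 y0 where xy0: "x0 \<in> Z" "y0 \<in> Z" "d x0 y0 = Suc n"
    using Z(3) by (metis le_SucE)
  then have U0: "x0 \<in> U" "y0 \<in> U" using Z(2) by auto
  define B where "B = separator U d n x0 y0"
  define X where "X = Z - B"
  have finB: "finite B" unfolding B_def by (rule fin[OF U0])
  have BU: "B \<subseteq> U" by (auto simp: B_def separator_def)
  have inU: "z \<in> U" if "z \<in> B \<union> X" for z using that BU Z(2) by (auto simp: X_def)
  have near: "d a z \<le> n" if "a \<in> B" "z \<in> B \<union> X" for a z
  proof (rule dist_separator_le[OF U0 xy0(3)])
    show "d z x0 \<le> Suc n" "d z y0 \<le> Suc n"
      using that Z(3) xy0 by (auto simp: X_def B_def separator_def)
  qed (use that inU in \<open>auto simp: B_def\<close>)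
  have sep: "separator U d n x y = B" if "x \<in> Z" "y \<in> Z" "d x y = Suc n" for x y
    unfolding B_def using that xy0 Z(2,3) by (intro separator_eq) auto
  have trans: "d x z \<le> n" if "x \<in> X" "y \<in> X" "z \<in> X" "d x y \<le> n" "d y z \<le> n" for x y z
  proof (rule ccontr)
    assume "\<not> d x z \<le> n"
    then have "separator U d n x z = B"
      using that Z(3) by (intro sep) (auto simp: X_def intro: le_antisym)
    moreover have "y \<in> separator U d n x z"
      using that inU d_commute[of x y] by (auto simp: separator_def)
    ultimately show False using that by (simp add: X_def)
  qed
  define cls where "cls x = {y \<in> X. d x y \<le> n}" for x
  have cls_eq: "cls x = cls y \<longleftrightarrow> d x y \<le> n" if "x \<in> X" "y \<in> X" for x y
  proof
    assume "cls x = cls y"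
    moreover have "y \<in> cls y" using that inU d_refl[of y] by (simp add: cls_def)
    ultimately show "d x y \<le> n" by (auto simp: cls_def)
  next
    assume "d x y \<le> n"
    moreover from this have "d y x \<le> n" using that inU d_commute[of x y] by simp
    ultimately show "cls x = cls y" unfolding cls_def using that trans by blast
  qed
  have sym: "inner (K x y v) u = inner (K y x u) v" if xy: "x \<in> U" "y \<in> U" "d x y \<le> Suc n" for x y u v
  proof (cases "d x y \<le> n")
    case True
    have "psd_kernel_on K {x, y}"
    proof (rule small)
      have "d x x = 0" "d y y = 0" "d y x = d x y" using xy d_refl d_commute by blast+
      then show "\<forall>a\<in>{x, y}. \<forall>b\<in>{x, y}. d a b \<le> n" using True by simp
    qed (use xy in auto)
    then show ?thesis unfolding psd_kernel_on_def by blast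
  next
    case False
    then have dist: "d x y = Suc n" "d y x = Suc n" using xy(3) d_commute[OF xy(1,2)] by linarith+
    note psd = psd_insert_separator[OF small fin[OF xy(1,2)] xy(1,2) dist(1)]
    have "central_form K (separator U d n x y) x u y v = central_form K (separator U d n x y) y v x u"
      using fin[OF xy(1,2)] psd by (intro central_form_commute) auto
    then show ?thesis
      using central xy dist separator_commute by metis
  qed
  have "psd_kernel_on K (B \<union> X)"
  proof (rule psd_kernel_on_amalgam[where cls = cls])
    show "finite B" "finite X" "B \<inter> X = {}" using finB Z(1) by (auto simp: X_def)
    show "psd_kernel_on K B"
      using finB BU near by (intro small) auto
    show "inner (K x y v) u = inner (K y x u) v" if "x \<in> B \<union> X" "y \<in> B \<union> X" for x y u v
    proof (rule sym)
      show "d x y \<le> Suc n"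
        using that near[of x y] near[of y x] Z(3) inU d_commute[of x y] by (fastforce simp: X_def)
    qed (use that inU in auto)
    show "psd_kernel_on K (B \<union> {x \<in> X. cls x = c})" for c
    proof (rule small)
      show "finite (B \<union> {x \<in> X. cls x = c})" using finB Z(1) by (simp add: X_def)
      show "B \<union> {x \<in> X. cls x = c} \<subseteq> U" using inU by auto
      show "\<forall>x\<in>B \<union> {x \<in> X. cls x = c}. \<forall>y\<in>B \<union> {x \<in> X. cls x = c}. d x y \<le> n"
        using near cls_eq inU d_commute by (smt (verit) Un_iff mem_Collect_eq)
    qed
    show "inner (K x y v) u = central_form K B x u y v"
      if "x \<in> X" "y \<in> X" "cls x \<noteq> cls y" for x y u v
    proof -
      have "x \<in> Z" "y \<in> Z" "d x y = Suc n"
        using that cls_eq[of x y] Z(3) by (auto simp: X_def intro: le_antisym)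
      then show ?thesis using central[of x y] sep[of x y] Z(2) by auto
    qed
  qed
  then show ?thesis
    by (rule psd_kernel_on_subset) (use finB Z(1) in \<open>auto simp: X_def\<close>)
qed

end

section \<open>Complex linearity and positive definite functions\<close>

lemma scaleC_1 [simp]: "1 *\<^sub>C x = x" for x :: "'h::complex_inner"
  using scaleR_scaleC[of 1 x] by simp

lemma cinner_scaleC_right: "cinner x (c *\<^sub>C y) = cnj c * cinner x y" for x :: "'h::complex_inner"
  using cinner_commute[of x "c *\<^sub>C y"] cinner_commute[of x y] by (simp add: cinner_scaleC_left)

lemma cinner_zero [simp]: "cinner 0 x = 0" "cinner x 0 = 0" for x :: "'h::complex_inner"
  using cinner_add_left[of 0 0 x] cinner_commute[of x 0] by simp_all

lemma cinner_sum_left: "cinner (\<Sum>i\<in>S. f i) x = (\<Sum>i\<in>S. cinner (f i) x)" for x :: "'h::complex_inner"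
  by (induction S rule: infinite_finite_induct) (simp_all add: cinner_add_left)

lemma inner_scaleC_i: "inner (\<i> *\<^sub>C x) (\<i> *\<^sub>C y) = inner x y" for x :: "'h::complex_inner"
  by (simp add: inner_eq_Re_cinner cinner_scaleC_left cinner_scaleC_right flip: mult.assoc)

lemma Im_cinner: "Im (cinner x y) = inner x (\<i> *\<^sub>C y)" for x :: "'h::complex_inner"
  by (simp add: inner_eq_Re_cinner cinner_scaleC_right)

lemma bounded_operatorsD:
  "T \<in> bounded_operators \<Longrightarrow> blinfun_apply T (c *\<^sub>C x) = c *\<^sub>C blinfun_apply T x"
  by (simp add: bounded_operators_def)

lemma bounded_operatorsI:
  fixes T :: "'h::complex_inner \<Rightarrow>\<^sub>L 'h"
  assumes "\<And>x. T (\<i> *\<^sub>C x) = \<i> *\<^sub>C T x"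
  shows "T \<in> bounded_operators"
proof -
  have "T (c *\<^sub>C x) = c *\<^sub>C T x" for c x
  proof -
    have split: "c *\<^sub>C z = Re c *\<^sub>R z + Im c *\<^sub>R (\<i> *\<^sub>C z)" for z :: 'h
    proof -
      have "c *\<^sub>C z = (complex_of_real (Re c) + complex_of_real (Im c) * \<i>) *\<^sub>C z"
        using complex_eq[of c] by (simp only: mult.commute)
      then show ?thesis by (simp only: scaleC_add_left scaleR_scaleC scaleC_scaleC)
    qed
    show ?thesis
      unfolding split by (simp add: blinfun.add_right blinfun.scaleR_right assms)
  qed
  then show ?thesis by (simp add: bounded_operators_def)
qed

text \<open>
  Multiplication by \<open>\<i>\<close> permutes the vectors over which the suprema are taken and preserves both
  the quadratic form and the pairing.
\<close>

lemma central_form_scaleC_i: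
  fixes K :: "'i \<Rightarrow> 'i \<Rightarrow> 'h::complex_inner \<Rightarrow>\<^sub>L 'h"
  assumes "\<And>b c. b \<in> insert x (insert y B) \<Longrightarrow> c \<in> B \<Longrightarrow> K b c \<in> bounded_operators"
  shows "central_form K B x (\<i> *\<^sub>C u) y (\<i> *\<^sub>C v) = central_form K B x u y v"
proof -
  let ?J = "\<lambda>h b. \<i> *\<^sub>C (h b :: 'h)"
  have surj: "surj ?J"
  proof (rule surjI)
    show "?J (\<lambda>b. (-\<i>) *\<^sub>C h b) = h" for h
      by (simp add: scaleC_scaleC)
  qed
  have "kernel_form K B (?J h) = kernel_form K B h" for h
    using assms by (simp add: kernel_form_def bounded_operatorsD inner_scaleC_i)
  moreover have "cross_form K B z (\<i> *\<^sub>C w) (?J h) = cross_form K B z w h" if "z \<in> {x, y}" for z w h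
    using assms that by (auto simp: cross_form_def bounded_operatorsD inner_scaleC_i)
  ultimately have
    "dual_form (kernel_form K B) (\<lambda>h. cross_form K B x (\<i> *\<^sub>C u) h + cross_form K B y (\<i> *\<^sub>C v) h) =
     dual_form (kernel_form K B) (\<lambda>h. cross_form K B x u h + cross_form K B y v h)"
    "dual_form (kernel_form K B) (\<lambda>h. cross_form K B x (\<i> *\<^sub>C u) h - cross_form K B y (\<i> *\<^sub>C v) h) =
     dual_form (kernel_form K B) (\<lambda>h. cross_form K B x u h - cross_form K B y v h)"
    using dual_form_reindex[OF surj, of "kernel_form K B" "\<lambda>h. cross_form K B x (\<i> *\<^sub>C u) h + cross_form K B y (\<i> *\<^sub>C v) h"]
      dual_form_reindex[OF surj, of "kernel_form K B" "\<lambda>h. cross_form K B x (\<i> *\<^sub>C u) h - cross_form K B y (\<i> *\<^sub>C v) h"]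
    by simp_all
  then show ?thesis by (simp add: central_form_def)
qed

lemma central_operator_bounded:
  fixes R :: "'h::complex_inner \<Rightarrow>\<^sub>L 'h" and K :: "'i \<Rightarrow> 'i \<Rightarrow> 'h::complex_inner \<Rightarrow>\<^sub>L 'h"
  assumes K: "\<And>b c. b \<in> insert x (insert y B) \<Longrightarrow> c \<in> B \<Longrightarrow> K b c \<in> bounded_operators"
    and R: "\<And>u v. inner (R v) u = central_form K B x u y v"
  shows "R \<in> bounded_operators"
proof (rule bounded_operatorsI)
  fix v
  have "inner (R (\<i> *\<^sub>C v)) u = inner (\<i> *\<^sub>C R v) u" for u
  proof -
    have u: "u = \<i> *\<^sub>C ((-\<i>) *\<^sub>C u)" by (simp add: scaleC_scaleC)
    have "inner (R (\<i> *\<^sub>C v)) (\<i> *\<^sub>C w) = inner (\<i> *\<^sub>C R v) (\<i> *\<^sub>C w)" for w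
      using central_form_scaleC_i[of x y B K w v] K by (simp add: R inner_scaleC_i)
    from this[of "(-\<i>) *\<^sub>C u"] show ?thesis unfolding u[symmetric] .
  qed
  then show "R (\<i> *\<^sub>C v) = \<i> *\<^sub>C R v"
    using vector_eq_rdot by blast
qed

lemma psd_operator_matrixI:
  fixes T :: "nat \<Rightarrow> nat \<Rightarrow> 'h::complex_inner \<Rightarrow>\<^sub>L 'h"
  assumes T: "\<And>i j. i < k \<Longrightarrow> j < k \<Longrightarrow> T i j \<in> bounded_operators"
    and sym: "\<And>i j u v. i < k \<Longrightarrow> j < k \<Longrightarrow> inner (T i j v) u = inner (T j i u) v"
    and nonneg: "\<And>h. 0 \<le> (\<Sum>i<k. \<Sum>j<k. inner (T i j (h j)) (h i))"
  shows "psd_operator_matrix k T"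
  unfolding psd_operator_matrix_def
proof (intro allI conjI)
  fix h :: "nat \<Rightarrow> 'h"
  let ?S = "\<Sum>i<k. cinner (\<Sum>j<k. T i j (h j)) (h i)"
  have S: "?S = (\<Sum>i<k. \<Sum>j<k. cinner (T i j (h j)) (h i))"
    by (simp add: cinner_sum_left)
  have adj: "cinner (T i j v) u = cnj (cinner (T j i u) v)" if ij: "i < k" "j < k" for i j u v
  proof (rule complex_eqI)
    show "Re (cinner (T i j v) u) = Re (cnj (cinner (T j i u) v))"
      using sym[OF ij] by (simp add: inner_eq_Re_cinner)
    have "Im (cinner (T i j v) u) = inner (T j i (\<i> *\<^sub>C u)) v"
      using sym[OF ij] by (simp add: Im_cinner)
    also have "\<dots> = - Im (cinner (T j i u) v)"
      using T[OF ij(2,1)] by (simp add: bounded_operatorsD inner_eq_Re_cinner cinner_scaleC_left)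
    finally show "Im (cinner (T i j v) u) = Im (cnj (cinner (T j i u) v))" by simp
  qed
  have "cnj ?S = (\<Sum>i<k. \<Sum>j<k. cinner (T j i (h i)) (h j))"
    unfolding S cnj_sum by (intro sum.cong refl) (simp add: adj[symmetric])
  also have "\<dots> = ?S" unfolding S by (rule sum.swap)
  finally show "?S \<in> \<real>" by (simp add: Reals_cnj_iff)
  show "0 \<le> Re ?S"
    unfolding S using nonneg[of h] by (simp add: inner_eq_Re_cinner)
qed

text \<open>
  Reality of the quadratic form forces self-adjointness: its polarization in the directions \<open>u\<close> and
  \<open>\<i> *\<^sub>C v\<close> has imaginary part \<open>inner (T 0 1 v) u - inner (T 1 0 u) v\<close>.
\<close>

lemma psd_operator_matrix_2_adjoint:
  fixes T :: "nat \<Rightarrow> nat \<Rightarrow> 'h::complex_inner \<Rightarrow>\<^sub>L 'h"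
  assumes T: "psd_operator_matrix 2 T" "T 0 1 \<in> bounded_operators" 
  shows "inner (T 0 1 v) u = inner (T 1 0 u) v"
proof -
  have real: "Im (cinner (T 0 0 u) u + cinner (T 0 1 v) u + cinner (T 1 0 u) v + cinner (T 1 1 v) v) = 0"
    for u v
  proof -
    define h where "h = (\<lambda>i::nat. if i = 0 then u else v)"
    have "(\<Sum>i<2. cinner (\<Sum>j<2. T i j (h j)) (h i)) \<in> \<real>"
      using T(1) by (simp add: psd_operator_matrix_def)
    then show ?thesis
      by (simp add: numeral_2_eq_2 h_def cinner_add_left complex_is_Real_iff add.assoc)
  qed
  have "Im (cinner (T 0 1 v) u + cinner (T 1 0 u) v) = 0" for u v
    using real[of u v] real[of u 0] real[of 0 v] by simp
  from this[of "\<i> *\<^sub>C v" u] show ?thesis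
    using T(2) by (simp add: bounded_operatorsD cinner_scaleC_left cinner_scaleC_right inner_eq_Re_cinner)
qed

lemma positive_definite_on_imp_psd_kernel_on:
  fixes \<phi> :: "'a \<Rightarrow> 'h::complex_inner \<Rightarrow>\<^sub>L 'h"
  assumes pd: "positive_definite_on G \<Sigma> \<phi>" and \<phi>: "\<phi> \<in> \<Sigma> \<rightarrow> bounded_operators"
    and Z: "finite Z" "Z \<subseteq> carrier G" "\<forall>x\<in>Z. \<forall>y\<in>Z. inv\<^bsub>G\<^esub> x \<otimes>\<^bsub>G\<^esub> y \<in> \<Sigma>"
  shows "psd_kernel_on (\<lambda>x y. \<phi> (inv\<^bsub>G\<^esub> x \<otimes>\<^bsub>G\<^esub> y)) Z"
proof -
  let ?K = "\<lambda>x y. \<phi> (inv\<^bsub>G\<^esub> x \<otimes>\<^bsub>G\<^esub> y)"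
  have psd: "psd_operator_matrix k (\<lambda>i j. ?K (s i) (s j))" if "\<forall>i<k. s i \<in> Z" for k s
    using pd Z that unfolding positive_definite_on_def by blast
  have "inner (?K x y v) u = inner (?K y x u) v" if "x \<in> Z" "y \<in> Z" for x y u v
  proof -
    define s where "s = (\<lambda>i::nat. if i = 0 then x else y)"
    have "psd_operator_matrix 2 (\<lambda>i j. ?K (s i) (s j))"
      using that by (intro psd) (simp add: s_def)
    moreover have "?K (s 0) (s 1) \<in> bounded_operators"
      using that Z(3) \<phi> by (auto simp: s_def)
    ultimately have "inner (?K (s 0) (s 1) v) u = inner (?K (s 1) (s 0) u) v"
      by (rule psd_operator_matrix_2_adjoint)
    then show ?thesis by (simp add: s_def)
  qed
  moreover have "0 \<le> kernel_form ?K Z h" for h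
  proof -
    obtain s where s: "bij_betw s {..<card Z} Z"
      using ex_bij_betw_nat_finite[OF Z(1)] by (auto simp: atLeast0LessThan)
    have "kernel_form ?K Z h = (\<Sum>i<card Z. \<Sum>j<card Z. inner (?K (s i) (s j) (h (s j))) (h (s i)))"
      unfolding kernel_form_def by (simp add: sum.reindex_bij_betw[OF s, symmetric])
    also have "\<dots> = Re (\<Sum>i<card Z. cinner (\<Sum>j<card Z. ?K (s i) (s j) (h (s j))) (h (s i)))"
      by (simp add: inner_eq_Re_cinner cinner_sum_left)
    also have "\<dots> \<ge> 0"
      using psd[of "card Z" s] s unfolding psd_operator_matrix_def bij_betw_def
      by (auto dest: spec[of _ "\<lambda>i. h (s i)"])
    finally show ?thesis .
  qed
  ultimately show ?thesis by (simp add: psd_kernel_on_def)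
qed

text \<open>
  A family of points with repetitions gives the form at the vector in which the entries of coinciding
  points are added up.  This lets finite sets replace the indexed families of
  \<open>positive_definite_on\<close>.
\<close>

lemma kernel_form_image:
  fixes K :: "'i \<Rightarrow> 'i \<Rightarrow> 'h::real_inner \<Rightarrow>\<^sub>L 'h"
  assumes "finite I"
  shows "(\<Sum>i\<in>I. \<Sum>j\<in>I. inner (K (s i) (s j) (h j)) (h i)) =
    kernel_form K (s ` I) (\<lambda>x. \<Sum>i | i \<in> I \<and> s i = x. h i)"
proof -
  have "(\<Sum>i\<in>I. \<Sum>j\<in>I. inner (K (s i) (s j) (h j)) (h i)) =
      (\<Sum>x\<in>s ` I. \<Sum>i | i \<in> I \<and> s i = x. \<Sum>j\<in>I. inner (K (s i) (s j) (h j)) (h i))"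
    by (rule sum.image_gen[OF assms])
  also have "\<dots> = (\<Sum>x\<in>s ` I. \<Sum>i | i \<in> I \<and> s i = x. \<Sum>y\<in>s ` I. \<Sum>j | j \<in> I \<and> s j = y.
      inner (K (s i) (s j) (h j)) (h i))"
    by (intro sum.cong refl sum.image_gen[OF assms])
  also have "\<dots> = (\<Sum>x\<in>s ` I. \<Sum>y\<in>s ` I. \<Sum>i | i \<in> I \<and> s i = x. \<Sum>j | j \<in> I \<and> s j = y.
      inner (K x y (h j)) (h i))"
    by (intro sum.cong refl) (subst sum.swap, simp)
  also have "\<dots> = kernel_form K (s ` I) (\<lambda>x. \<Sum>i | i \<in> I \<and> s i = x. h i)"
    by (simp add: kernel_form_def blinfun.sum_right inner_sum_left inner_sum_right)
  finally show ?thesis .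
qed

lemma positive_definite_onI:
  fixes \<phi> :: "'a \<Rightarrow> 'h::complex_inner \<Rightarrow>\<^sub>L 'h"
  assumes \<phi>: "\<phi> \<in> \<Sigma> \<rightarrow> bounded_operators"
    and psd: "\<And>Z. finite Z \<Longrightarrow> Z \<subseteq> carrier G \<Longrightarrow> \<forall>x\<in>Z. \<forall>y\<in>Z. inv\<^bsub>G\<^esub> x \<otimes>\<^bsub>G\<^esub> y \<in> \<Sigma> \<Longrightarrow>
      psd_kernel_on (\<lambda>x y. \<phi> (inv\<^bsub>G\<^esub> x \<otimes>\<^bsub>G\<^esub> y)) Z"
  shows "positive_definite_on G \<Sigma> \<phi>"
  unfolding positive_definite_on_def
proof (intro allI impI)
  fix k and s :: "nat \<Rightarrow> 'a"
  assume s: "\<forall>i<k. s i \<in> carrier G" and \<Sigma>: "\<forall>i<k. \<forall>j<k. inv\<^bsub>G\<^esub> (s i) \<otimes>\<^bsub>G\<^esub> s j \<in> \<Sigma>"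
  have "psd_kernel_on (\<lambda>x y. \<phi> (inv\<^bsub>G\<^esub> x \<otimes>\<^bsub>G\<^esub> y)) (s ` {..<k})"
    using s \<Sigma> by (intro psd) auto
  then show "psd_operator_matrix k (\<lambda>i j. \<phi> (inv\<^bsub>G\<^esub> (s i) \<otimes>\<^bsub>G\<^esub> s j))"
    using \<Sigma> \<phi> kernel_form_image[of "{..<k}" "\<lambda>x y. \<phi> (inv\<^bsub>G\<^esub> x \<otimes>\<^bsub>G\<^esub> y)" s]
    by (intro psd_operator_matrixI) (auto simp: psd_kernel_on_def)
qed


section \<open>The Cayley tree of a free group\<close>

fun lcp :: "'a list \<Rightarrow> 'a list \<Rightarrow> nat" where
  "lcp (x # u) (y # v) = (if x = y then Suc (lcp u v) else 0)"
| "lcp _ _ = 0"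

lemma le_lcp_iff: "k \<le> lcp u v \<longleftrightarrow> k \<le> length u \<and> k \<le> length v \<and> take k u = take k v"
proof (induction u v arbitrary: k rule: lcp.induct)
  case (1 x u y v)
  then show ?case by (cases k) auto
qed auto

lemma lcp_commute: "lcp u v = lcp v u"
  by (induction u v rule: lcp.induct) auto

text \<open>
  The common prefix is the Gromov product based at the unit, and this is its hyperbolicity
  inequality with constant zero.
\<close>

lemma lcp_ultrametric: "min (lcp u v) (lcp u w) \<le> lcp v w"
proof -
  have "k \<le> lcp v w" if "k \<le> lcp u v" "k \<le> lcp u w" for k
    using that unfolding le_lcp_iff by auto
  then show ?thesis by simp
qed

text \<open>
  In \<open>u\<inverse>v\<close> exactly the common prefix cancels.
\<close>

lemma length_foldr_push_inverse:
  assumes "reduced u" "reduced v"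
  shows "length (foldr push (rev (map flip u)) v) + 2 * lcp u v = length u + length v"
  using assms
proof (induction u arbitrary: v)
  case (Cons x u)
  have u: "reduced u" using Cons.prems(1) by (rule reduced_Cons)
  show ?case
  proof (cases "\<exists>v'. v = x # v'")
    case True
    then obtain v' where v: "v = x # v'" by blast
    then show ?thesis using Cons.IH[OF u, of v'] Cons.prems(2) reduced_Cons[of x v'] by simp
  next
    case False
    then have "push (flip x) v = flip x # v" and "lcp (x # u) v = 0"
      by (cases v; auto)+
    moreover have "reduced (flip x # v)" using False Cons.prems(2) by (cases v) auto
    moreover have "lcp u (flip x # v) = 0" using Cons.prems(1) by (cases u) auto
    ultimately show ?thesis using Cons.IH[OF u, of "flip x # v"] by simp
  qed
qed (simp add: reduce_reduced)

definition word_dist :: "'g set \<Rightarrow> 'g word \<Rightarrow> 'g word \<Rightarrow> nat" where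
  "word_dist A x y = length (inv\<^bsub>free_group A\<^esub> x \<otimes>\<^bsub>free_group A\<^esub> y)"

lemma word_dist_lcp:
  assumes "x \<in> carrier (free_group A)" "y \<in> carrier (free_group A)"
  shows "word_dist A x y + 2 * lcp x y = length x + length y"
  unfolding word_dist_def inv_free_group[OF assms(1)]
  using assms length_foldr_push_inverse[of x y] by (simp add: free_group_def reduce_append)

lemma inv_mult_translate:
  assumes "g \<in> carrier (free_group A)" "x \<in> carrier (free_group A)" "y \<in> carrier (free_group A)"
  shows "inv\<^bsub>free_group A\<^esub> (g \<otimes>\<^bsub>free_group A\<^esub> x) \<otimes>\<^bsub>free_group A\<^esub> (g \<otimes>\<^bsub>free_group A\<^esub> y) =
    inv\<^bsub>free_group A\<^esub> x \<otimes>\<^bsub>free_group A\<^esub> y"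
proof -
  interpret group "free_group A" by (rule group_free_group)
  show ?thesis
    using assms by (simp add: inv_mult_group m_assoc inv_solve_left' )
qed

text \<open>
  After translating one of the four points to the unit, the four-point condition becomes
  \<open>lcp_ultrametric\<close>.
\<close>

lemma tree_metric_free_group: "tree_metric (carrier (free_group A)) (word_dist A)"
proof
  interpret group "free_group A" by (rule group_free_group)
  let ?F = "carrier (free_group A)"
  show "word_dist A x x = 0" if "x \<in> ?F" for x
    using that by (simp add: word_dist_def) (simp add: free_group_def)
  show "word_dist A x y = word_dist A y x" if "x \<in> ?F" "y \<in> ?F" for x y
    using word_dist_lcp[OF that] word_dist_lcp[OF that(2,1)] lcp_commute[of x y] by simp
  show "word_dist A z w + word_dist A x y \<le> max (word_dist A z x + word_dist A w y) (word_dist A z y + word_dist A w x)"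
    if xyzw: "x \<in> ?F" "y \<in> ?F" "z \<in> ?F" "w \<in> ?F" for x y z w
  proof -
    define t where "t v = inv\<^bsub>free_group A\<^esub> w \<otimes>\<^bsub>free_group A\<^esub> v" for v
    have t: "t v \<in> ?F" if "v \<in> ?F" for v using that xyzw by (simp add: t_def)
    have t_dist: "word_dist A u v = word_dist A (t u) (t v)" if "u \<in> ?F" "v \<in> ?F" for u v
      using that xyzw inv_mult_translate[of "inv\<^bsub>free_group A\<^esub> w" A u v]
      by (simp add: word_dist_def t_def)
    have w_dist: "word_dist A w v = length (t v)" for v by (simp add: word_dist_def t_def)
    have z_dist: "word_dist A z w = length (t z)"
      using word_dist_lcp[of z A w] word_dist_lcp[of w A z] xyzw lcp_commute[of z w] w_dist[of z] by simp
    have "min (lcp (t z) (t x)) (lcp (t z) (t y)) \<le> lcp (t x) (t y)" by (rule lcp_ultrametric)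
    then show ?thesis
      unfolding w_dist z_dist t_dist[OF xyzw(1,2)] t_dist[OF xyzw(3,1)] t_dist[OF xyzw(3,2)]
      using word_dist_lcp[OF t t, OF xyzw(1,2)] word_dist_lcp[OF t t, OF xyzw(3,1)]
        word_dist_lcp[OF t t, OF xyzw(3,2)]
      by linarith
  qed
qed

lemma finite_word_ball: "finite A \<Longrightarrow> finite (word_ball A n)"
proof -
  assume "finite A"
  then have "finite {w. set w \<subseteq> A \<times> (UNIV :: bool set) \<and> length w \<le> n}"
    by (intro finite_lists_length_le) simp
  then show ?thesis
    by (rule rev_finite_subset) (force simp: word_ball_def free_group_def)
qed

section \<open>Tree automorphisms that fix the unit\<close>

text \<open>
  Besides \<open>c\<close> and \<open>b\<close>, their inverses are exchanged as well, so that the permutation commutes with \<open>flip\<close> and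
  maps reduced words to reduced words.
\<close>

definition swap_letter :: "'g \<times> bool \<Rightarrow> 'g \<times> bool \<Rightarrow> 'g \<times> bool \<Rightarrow> 'g \<times> bool" where
  "swap_letter c b l = (if l = c then b else if l = b then c
     else if l = flip c then flip b else if l = flip b then flip c else l)"

text \<open>
  Exchanges the two branches of the Cayley tree that leave the vertex \<open>p\<close> along the letters \<open>c\<close> and
  \<open>b\<close>, and fixes every word outside of them.
\<close>

fun swap_branches :: "'g word \<Rightarrow> 'g \<times> bool \<Rightarrow> 'g \<times> bool \<Rightarrow> 'g word \<Rightarrow> 'g word" where
  "swap_branches p c b [] = []"
| "swap_branches [] c b (y # w) = (if y = c \<or> y = b then map (swap_letter c b) (y # w) else y # w)"
| "swap_branches (x # p) c b (y # w) = (if y = x then y # swap_branches p c b w else y # w)"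

lemma flip_eq_flip [simp]: "flip x = flip y \<longleftrightarrow> x = y"
  by (metis flip_flip)

lemma swap_letter_simps [simp]:
  "swap_letter c b c = b" "swap_letter c b b = c"
  "swap_letter c b (flip l) = flip (swap_letter c b l)"
  "swap_letter c b (swap_letter c b l) = l"
  unfolding swap_letter_def by (auto split: if_splits)

lemma reduced_map_swap_letter: "reduced w \<Longrightarrow> reduced (map (swap_letter c b) w)"
proof (induction w rule: reduced.induct)
  case (1 x y w)
  have "swap_letter c b y \<noteq> flip (swap_letter c b x)"
    using 1(2) by (metis reduced.simps(1) swap_letter_simps(3,4))
  then show ?case using 1 by simp
qed auto

lemma length_swap_branches [simp]: "length (swap_branches p c b w) = length w"
  by (induction p c b w rule: swap_branches.induct) auto

lemma take_swap_branches: "take k (swap_branches p c b w) = swap_branches p c b (take k w)"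
proof (induction p c b w arbitrary: k rule: swap_branches.induct)
  case (2 c b y w)
  then show ?case by (cases k) (auto simp: take_map)
next
  case (3 x p c b y w)
  then show ?case by (cases k) auto
qed auto

lemma swap_branches_involution: "swap_branches p c b (swap_branches p c b w) = w"
  by (induction p c b w rule: swap_branches.induct) (auto simp: o_def map_idI)

lemma swap_branches_snoc: "swap_branches p c b (p @ [c]) = p @ [b]"
  by (induction p) auto

lemma reduced_swap_branches:
  assumes "reduced (p @ [c])" "reduced (p @ [b])" "reduced w"
  shows "reduced (swap_branches p c b w)"
  using assms
proof (induction p c b w rule: swap_branches.induct)
  case (2 c b y w)
  then show ?case using reduced_map_swap_letter[of "y # w" c b] by simp
next
  case (3 x p c b y w)
  show ?case
  proof (cases "y = x")
    case True
    have red: "reduced (swap_branches p c b w)"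
      using 3 True by (auto dest: reduced_Cons)
    show ?thesis
    proof (cases w)
      case (Cons z w')
      have "hd (swap_branches p c b w) \<noteq> flip x"
        using 3(2-4) Cons True by (cases p) auto
      moreover have "swap_branches p c b w \<noteq> []"
        using Cons length_swap_branches[of p c b w] by (metis length_0_conv list.distinct(1))
      ultimately show ?thesis
        using True red by (cases "swap_branches p c b w") auto
    qed (use True in simp)
  qed (use 3 in simp)
qed auto

lemma letters_swap_branches:
  assumes "fst c \<in> A" "fst b \<in> A" "fst ` set w \<subseteq> A"
  shows "fst ` set (swap_branches p c b w) \<subseteq> A"
  using assms by (induction p c b w rule: swap_branches.induct) (auto simp: swap_letter_def)

text \<open>
  The prefixes of a word are the vertices on its path from the unit, so commuting with
  \<open>take\<close> says that adjacency is respected.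
\<close>

definition rooted_automorphism :: "'g set \<Rightarrow> ('g word \<Rightarrow> 'g word) \<Rightarrow> bool" where
  "rooted_automorphism A g \<longleftrightarrow> bij_betw g (carrier (free_group A)) (carrier (free_group A)) \<and>
     (\<forall>w\<in>carrier (free_group A). length (g w) = length w \<and> (\<forall>k. take k (g w) = g (take k w)))"

lemma reduced_take: "reduced w \<Longrightarrow> reduced (take k w)"
proof (induction w arbitrary: k rule: reduced.induct)
  case (1 x y w)
  then show ?case by (cases k; cases "k - 1") (auto dest: spec[of _ "k - 1"], metis take_Suc_Cons)
qed (auto simp: take_Cons')

lemma take_in_free_group: "w \<in> carrier (free_group A) \<Longrightarrow> take k w \<in> carrier (free_group A)"
  by (auto simp: free_group_def reduced_take dest: in_set_takeD)

lemma rooted_automorphism_swap_branches: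
  assumes "p @ [c] \<in> carrier (free_group A)" "p @ [b] \<in> carrier (free_group A)"
  shows "rooted_automorphism A (swap_branches p c b)"
proof -
  have "swap_branches p c b w \<in> carrier (free_group A)" if "w \<in> carrier (free_group A)" for w
    using assms that reduced_swap_branches[of p c b w] letters_swap_branches[of c A b w p]
    by (simp add: free_group_def)
  then have "bij_betw (swap_branches p c b) (carrier (free_group A)) (carrier (free_group A))"
    by (intro bij_betw_byWitness[where f' = "swap_branches p c b"])
      (auto simp: swap_branches_involution)
  then show ?thesis by (simp add: rooted_automorphism_def take_swap_branches)
qed

lemma rooted_automorphism_comp:
  assumes "rooted_automorphism A g" "rooted_automorphism A h"
  shows "rooted_automorphism A (h \<circ> g)"
  using assms bij_betw_trans[of g _ "carrier (free_group A)" h]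
  by (auto simp: rooted_automorphism_def bij_betwE)

text \<open>
  An automorphism that takes the parent of \<open>s\<close> to the parent of \<open>t\<close> takes \<open>s\<close> to a child of the latter;
  swapping two branches there corrects the last letter.
\<close>

lemma rooted_automorphism_transitive:
  assumes "s \<in> carrier (free_group A)" "t \<in> carrier (free_group A)" "length s = length t"
  shows "\<exists>g. rooted_automorphism A g \<and> g s = t"
  using assms
proof (induction s arbitrary: t rule: rev_induct)
  case Nil
  then show ?case by (intro exI[of _ "\<lambda>w. w"]) (auto simp: rooted_automorphism_def bij_betw_def)
next
  case (snoc c s)
  obtain t' b where t: "t = t' @ [b]"
    using snoc.prems(3) by (cases t rule: rev_cases) auto
  have "s \<in> carrier (free_group A)" "t' \<in> carrier (free_group A)" "length s = length t'"
    using snoc.prems take_in_free_group[of "s @ [c]" A "length s"]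
      take_in_free_group[of "t' @ [b]" A "length t'"] by (auto simp: t)
  then obtain g where g: "rooted_automorphism A g" "g s = t'" using snoc.IH by blast
  have gsc: "length (g (s @ [c])) = Suc (length s)" "take (length s) (g (s @ [c])) = t'"
    "g (s @ [c]) \<in> carrier (free_group A)"
    using g snoc.prems(1) by (auto simp: rooted_automorphism_def bij_betwE)
  then obtain c' where c': "g (s @ [c]) = t' @ [c']"
    by (cases "g (s @ [c])" rule: rev_cases) auto
  have "rooted_automorphism A (swap_branches t' c' b \<circ> g)"
    using gsc(3) snoc.prems(2) t c' g(1)
    by (intro rooted_automorphism_comp rooted_automorphism_swap_branches) auto
  moreover have "(swap_branches t' c' b \<circ> g) (s @ [c]) = t"
    by (simp add: c' t swap_branches_snoc)
  ultimately show ?case by blast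
qed

text \<open>
  An automorphism preserves lengths and common prefixes, and these determine the distance.
\<close>

lemma rooted_automorphism_isometry:
  assumes g: "rooted_automorphism A g"
    and xy: "x \<in> carrier (free_group A)" "y \<in> carrier (free_group A)"
  shows "word_dist A (g x) (g y) = word_dist A x y"
proof -
  have "inj_on g (carrier (free_group A))" using g by (simp add: rooted_automorphism_def bij_betw_def)
  then have "k \<le> lcp (g x) (g y) \<longleftrightarrow> k \<le> lcp x y" for k
    using g xy inj_on_eq_iff[of g _ "take k x" "take k y"]
    by (simp add: le_lcp_iff rooted_automorphism_def take_in_free_group)
  then have "lcp (g x) (g y) = lcp x y" by (meson dual_order.antisym le_refl)
  moreover have "g x \<in> carrier (free_group A)" "g y \<in> carrier (free_group A)"
    "length (g x) = length x" "length (g y) = length y"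
    using g xy by (auto simp: rooted_automorphism_def bij_betwE)
  ultimately show ?thesis
    using word_dist_lcp[of "g x" A "g y"] word_dist_lcp[of x A y] xy by simp
qed


section \<open>Extension of positive definite functions\<close>

lemma separator_image:
  assumes g: "bij_betw g U U" and iso: "\<And>x y. x \<in> U \<Longrightarrow> y \<in> U \<Longrightarrow> d (g x) (g y) = d x y"
    and "x \<in> U" "y \<in> U"
  shows "g ` separator U d n x y = separator U d n (g x) (g y)"
proof
  show "g ` separator U d n x y \<subseteq> separator U d n (g x) (g y)"
    using assms by (auto simp: separator_def bij_betwE)
  show "separator U d n (g x) (g y) \<subseteq> g ` separator U d n x y"
  proof
    fix w assume w: "w \<in> separator U d n (g x) (g y)"
    then obtain z where "z \<in> U" "w = g z"
      using g by (auto simp: separator_def bij_betw_def)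
    then show "w \<in> g ` separator U d n x y"
      using w assms by (auto simp: separator_def)
  qed
qed

lemma psd_kernel_on_cong:
  assumes "\<And>x y. x \<in> Z \<Longrightarrow> y \<in> Z \<Longrightarrow> K x y = K' x y"
  shows "psd_kernel_on K Z \<longleftrightarrow> psd_kernel_on K' Z"
  using assms by (simp add: psd_kernel_on_def kernel_form_def)

lemma inv_mult_in_word_ball_iff:
  assumes "x \<in> carrier (free_group A)" "y \<in> carrier (free_group A)"
  shows "inv\<^bsub>free_group A\<^esub> x \<otimes>\<^bsub>free_group A\<^esub> y \<in> word_ball A n \<longleftrightarrow> word_dist A x y \<le> n"
proof -
  interpret group "free_group A" by (rule group_free_group)
  show ?thesis using assms by (simp add: word_ball_def word_dist_def)
qed

text \<open>
  The central value is taken at the pairs consisting of the unit and a word \<open>s\<close> of length \<open>n + 1\<close>.  Left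
  translation by \<open>x\<close> carries such a pair, its separator and the kernel on them to the pair \<open>x\<close>,
  \<open>x s\<close>, so every entry at distance \<open>n + 1\<close> is central, as \<open>psd_kernel_on_central_completion\<close> requires.
  If \<open>\<phi>\<close> is radial, a rooted automorphism that takes \<open>s\<close> to \<open>t\<close> carries the data that
  define the value at \<open>s\<close> to those that define the value at \<open>t\<close>.
\<close>

theorem positive_definite_extension_step:
  fixes \<phi> :: "'g word \<Rightarrow> 'h::chilbert_space \<Rightarrow>\<^sub>L 'h"
  assumes A: "finite A" and \<phi>: "\<phi> \<in> word_ball A n \<rightarrow> bounded_operators"
    and pd: "positive_definite_on (free_group A) (word_ball A n) \<phi>"
  shows "\<exists>\<psi> \<in> word_ball A (Suc n) \<rightarrow> bounded_operators.
    (\<forall>s \<in> word_ball A n. \<psi> s = \<phi> s) \<and>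
    positive_definite_on (free_group A) (word_ball A (Suc n)) \<psi> \<and>
    (radial_on (word_ball A n) \<phi> \<longrightarrow> radial_on (word_ball A (Suc n)) \<psi>)"
proof -
  interpret G: group "free_group A" by (rule group_free_group)
  interpret tree_metric "carrier (free_group A)" "word_dist A" by (rule tree_metric_free_group)
  let ?G = "free_group A" and ?F = "carrier (free_group A)" and ?d = "word_dist A"
  let ?e = "\<one>\<^bsub>?G\<^esub>" and ?sep = "separator ?F ?d n"
  define K where "K x y = \<phi> (inv\<^bsub>?G\<^esub> x \<otimes>\<^bsub>?G\<^esub> y)" for x y
  have K_bounded: "K x y \<in> bounded_operators" if "x \<in> ?F" "y \<in> ?F" "?d x y \<le> n" for x y
    unfolding K_def using \<phi> inv_mult_in_word_ball_iff[OF that(1,2)] that(3) by (metis PiE)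
  have small: "psd_kernel_on K Z"
    if "finite Z" "Z \<subseteq> ?F" "\<forall>x\<in>Z. \<forall>y\<in>Z. ?d x y \<le> n" for Z
    unfolding K_def[abs_def]
  proof (rule positive_definite_on_imp_psd_kernel_on[OF pd \<phi> that(1,2)])
    show "\<forall>x\<in>Z. \<forall>y\<in>Z. inv\<^bsub>?G\<^esub> x \<otimes>\<^bsub>?G\<^esub> y \<in> word_ball A n"
    proof (intro ballI)
      fix x y assume "x \<in> Z" "y \<in> Z"
      then show "inv\<^bsub>?G\<^esub> x \<otimes>\<^bsub>?G\<^esub> y \<in> word_ball A n"
        using that(2,3) inv_mult_in_word_ball_iff[of x A y n] by blast
    qed
  qed
  have dist_e: "?d ?e s = length s" if "s \<in> ?F" for s
    using that by (simp add: word_dist_def)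
  have fin: "finite (?sep x y)" if xy: "x \<in> ?F" "y \<in> ?F" for x y
  proof -
    \<comment> \<open>The separator lies in the ball of radius \<open>n\<close> around \<open>x\<close>.\<close>
    have "?sep x y \<subseteq> (\<lambda>z. x \<otimes>\<^bsub>?G\<^esub> z) ` word_ball A n"
    proof
      fix z assume z: "z \<in> ?sep x y"
      then have "z = x \<otimes>\<^bsub>?G\<^esub> (inv\<^bsub>?G\<^esub> x \<otimes>\<^bsub>?G\<^esub> z)"
        using xy by (simp add: separator_def flip: G.m_assoc)
      moreover have "inv\<^bsub>?G\<^esub> x \<otimes>\<^bsub>?G\<^esub> z \<in> word_ball A n"
        using z xy inv_mult_in_word_ball_iff[of x A z n] d_commute[of x z] by (simp add: separator_def)
      ultimately show "z \<in> (\<lambda>z. x \<otimes>\<^bsub>?G\<^esub> z) ` word_ball A n" by blast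
    qed
    then show ?thesis using finite_word_ball[OF A] by (meson finite_imageI finite_subset)
  qed
  \<comment> \<open>All entries that enter the central value at \<open>s\<close> are among the prescribed ones.\<close>
  have sep_close: "?d a b \<le> n"
    if "s \<in> ?F" "length s = Suc n" "a \<in> insert ?e (insert s (?sep ?e s))" "b \<in> ?sep ?e s" for s a b
  proof -
    have "?d b a \<le> n"
    proof (rule dist_separator_le[of ?e s])
      show "?d a ?e \<le> Suc n" "?d a s \<le> Suc n" "a \<in> ?F"
        using that d_commute[of s ?e] dist_e[of s] d_refl[of s] d_refl[of ?e]
        by (auto simp: separator_def)
    qed (use that dist_e in auto)
    moreover have "a \<in> ?F" "b \<in> ?F" using that by (auto simp: separator_def)
    ultimately show ?thesis using d_commute[of a b] by simp
  qed
  have "\<exists>R. \<forall>u v. inner (blinfun_apply R v) u = central_form K (?sep ?e s) ?e u s v"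
    if s: "s \<in> ?F" "length s = Suc n" for s
  proof (rule central_operator_exists)
    have dist: "?d ?e s = Suc n" using s dist_e by simp
    note psd_insert_separator[OF small fin[OF G.one_closed s(1)] G.one_closed s(1) dist]
    then show "?e \<notin> ?sep ?e s" "s \<notin> ?sep ?e s"
      "psd_kernel_on K (insert ?e (?sep ?e s))" "psd_kernel_on K (insert s (?sep ?e s))"
      by blast+
  qed (use fin s in simp)
  then obtain R where R: "\<And>s u v. s \<in> ?F \<Longrightarrow> length s = Suc n \<Longrightarrow>
      inner (blinfun_apply (R s) v) u = central_form K (?sep ?e s) ?e u s v"
    by metis
  define \<psi> where "\<psi> s = (if length s \<le> n then \<phi> s else R s)" for s
  define K' where "K' x y = \<psi> (inv\<^bsub>?G\<^esub> x \<otimes>\<^bsub>?G\<^esub> y)" for x y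
  have K'_K: "K' x y = K x y" if "?d x y \<le> n" for x y
    using that by (simp add: K'_def K_def \<psi>_def word_dist_def)
  have \<psi>_bounded: "\<psi> \<in> word_ball A (Suc n) \<rightarrow> bounded_operators"
  proof
    fix s assume s: "s \<in> word_ball A (Suc n)"
    show "\<psi> s \<in> bounded_operators"
    proof (cases "length s \<le> n")
      case True
      then show ?thesis using s \<phi> by (auto simp: \<psi>_def word_ball_def)
    next
      case False
      then have sF: "s \<in> ?F" "length s = Suc n" using s by (auto simp: word_ball_def)
      have "R s \<in> bounded_operators"
      proof (rule central_operator_bounded[OF _ R[OF sF]])
        fix b c assume bc: "b \<in> insert ?e (insert s (?sep ?e s))" "c \<in> ?sep ?e s"
        then have "b \<in> ?F" "c \<in> ?F" using sF by (auto simp: separator_def)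
        then show "K b c \<in> bounded_operators" using sep_close[OF sF bc] by (rule K_bounded)
      qed
      then show ?thesis using False by (simp add: \<psi>_def)
    qed
  qed
  have transport: "inner (K' x y v) u = central_form K' (?sep x y) x u y v"
    if xy: "x \<in> ?F" "y \<in> ?F" "?d x y = Suc n" for x y u v
  proof -
    define s where "s = inv\<^bsub>?G\<^esub> x \<otimes>\<^bsub>?G\<^esub> y"
    have s: "s \<in> ?F" "length s = Suc n" using xy by (simp_all add: s_def word_dist_def)
    let ?g = "\<lambda>z. x \<otimes>\<^bsub>?G\<^esub> z"
    have K_translate: "K (?g a) (?g b) = K a b" if "a \<in> ?F" "b \<in> ?F" for a b
      using inv_mult_translate[OF xy(1) that] by (simp add: K_def)
    have iso: "?d (?g a) (?g b) = ?d a b" if "a \<in> ?F" "b \<in> ?F" for a b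
      using inv_mult_translate[OF xy(1) that] by (simp add: word_dist_def)
    have "bij_betw ?g ?F ?F"
      by (rule bij_betw_byWitness[where f' = "\<lambda>z. inv\<^bsub>?G\<^esub> x \<otimes>\<^bsub>?G\<^esub> z"])
        (use xy in \<open>auto simp flip: G.m_assoc\<close>)
    note bij = this
    have gs: "?g s = y" using xy by (simp add: s_def flip: G.m_assoc)
    have ge: "?g ?e = x" using xy by simp
    have sep: "?g ` ?sep ?e s = ?sep x y"
      using separator_image[where g = ?g and d = ?d and n = n, OF bij iso G.one_closed s(1)] unfolding gs ge by blast
    have K'_transport: "K' (?g a) (?g b) = K a b" if "a \<in> insert ?e (insert s (?sep ?e s))" "b \<in> ?sep ?e s" for a b
    proof -
      have "a \<in> ?F" "b \<in> ?F" using that s by (auto simp: separator_def)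
      then show ?thesis using sep_close[OF s that] K'_K[of "?g a" "?g b"] iso K_translate by simp
    qed
    have "central_form K' (?g ` ?sep ?e s) x u y v = central_form K (?sep ?e s) ?e u s v"
    proof (rule central_form_transport)
      show "inj_on ?g (?sep ?e s)"
        using bij by (auto simp: bij_betw_def separator_def intro: inj_on_subset)
      show "K' (?g b) (?g c) = K b c" if "b \<in> ?sep ?e s" "c \<in> ?sep ?e s" for b c
        using K'_transport that by blast
      show "K' x (?g b) = K ?e b" "K' y (?g b) = K s b" if "b \<in> ?sep ?e s" for b
        using K'_transport[of ?e b] K'_transport[of s b] that unfolding gs ge by blast+
    qed
    moreover have "K' x y = R s"
      using s by (simp add: K'_def \<psi>_def s_def)
    ultimately show ?thesis using R[OF s] sep by simp
  qed
  have pd': "positive_definite_on ?G (word_ball A (Suc n)) \<psi>"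
  proof (rule positive_definite_onI[OF \<psi>_bounded])
    fix Z assume Z: "finite Z" "Z \<subseteq> ?F" "\<forall>x\<in>Z. \<forall>y\<in>Z. inv\<^bsub>?G\<^esub> x \<otimes>\<^bsub>?G\<^esub> y \<in> word_ball A (Suc n)"
    have "psd_kernel_on K' Z"
    proof (rule psd_kernel_on_central_completion[where n = n])
      show "psd_kernel_on K' W" if "finite W" "W \<subseteq> ?F" "\<forall>x\<in>W. \<forall>y\<in>W. ?d x y \<le> n" for W
        using small[OF that] psd_kernel_on_cong[of W K' K] K'_K that(3) by blast
      show "\<forall>x\<in>Z. \<forall>y\<in>Z. ?d x y \<le> Suc n"
      proof (intro ballI)
        fix x y assume "x \<in> Z" "y \<in> Z"
        then show "?d x y \<le> Suc n"
          using Z(2,3) inv_mult_in_word_ball_iff[of x A y "Suc n"] by blast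
      qed
      show "inner (K' x y v) u = central_form K' (?sep x y) x u y v"
        if "x \<in> ?F" "y \<in> ?F" "?d x y = Suc n" for x y u v
        using that by (rule transport)
    qed (rule Z(1) Z(2) fin; assumption?)+
    then show "psd_kernel_on (\<lambda>x y. \<psi> (inv\<^bsub>?G\<^esub> x \<otimes>\<^bsub>?G\<^esub> y)) Z"
      by (simp add: K'_def[abs_def])
  qed
  have radial': "radial_on (word_ball A (Suc n)) \<psi>" if radial: "radial_on (word_ball A n) \<phi>"
    unfolding radial_on_def
  proof (intro ballI impI)
    fix s t assume st: "s \<in> word_ball A (Suc n)" "t \<in> word_ball A (Suc n)" "length s = length t"
    have K_dist: "K x y = K x' y'"
      if "x \<in> ?F" "y \<in> ?F" "x' \<in> ?F" "y' \<in> ?F" "?d x y \<le> n" "?d x' y' = ?d x y" for x y x' y'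
    proof -
      have "inv\<^bsub>?G\<^esub> x \<otimes>\<^bsub>?G\<^esub> y \<in> word_ball A n" "inv\<^bsub>?G\<^esub> x' \<otimes>\<^bsub>?G\<^esub> y' \<in> word_ball A n"
        using that inv_mult_in_word_ball_iff[of x A y n] inv_mult_in_word_ball_iff[of x' A y' n] by simp_all
      moreover have "length (inv\<^bsub>?G\<^esub> x \<otimes>\<^bsub>?G\<^esub> y) = length (inv\<^bsub>?G\<^esub> x' \<otimes>\<^bsub>?G\<^esub> y')"
        using that(6) by (simp add: word_dist_def)
      ultimately show ?thesis
        using radial unfolding K_def radial_on_def by blast
    qed
    show "\<psi> s = \<psi> t"
    proof (cases "length s \<le> n")
      case True
      then have "s \<in> word_ball A n" "t \<in> word_ball A n" using st by (simp_all add: word_ball_def)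
      then have "\<phi> s = \<phi> t" using st(3) radial unfolding radial_on_def by blast
      then show ?thesis using True st(3) by (simp add: \<psi>_def)
    next
      case False
      then have s: "s \<in> ?F" "length s = Suc n" and t: "t \<in> ?F" "length t = Suc n"
        using st by (auto simp: word_ball_def)
      obtain g where g: "rooted_automorphism A g" "g s = t"
        using rooted_automorphism_transitive[OF s(1) t(1) st(3)] by blast
      have bij: "bij_betw g ?F ?F" using g by (simp add: rooted_automorphism_def)
      have ge: "g ?e = ?e"
        using g(1) G.one_closed unfolding rooted_automorphism_def
        by (metis dist_e d_refl length_0_conv)
      have iso: "?d (g a) (g b) = ?d a b" if "a \<in> ?F" "b \<in> ?F" for a b
        using rooted_automorphism_isometry[OF g(1) that] .
      have sep: "g ` ?sep ?e s = ?sep ?e t"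
        using separator_image[where g = g and d = ?d and n = n, OF bij iso G.one_closed s(1)] unfolding g(2) ge by blast
      have K_g: "K (g a) (g b) = K a b"
        if "a \<in> insert ?e (insert s (?sep ?e s))" "b \<in> ?sep ?e s" for a b
      proof -
        have "a \<in> ?F" "b \<in> ?F" using that s by (auto simp: separator_def)
        then show ?thesis
          using K_dist[of a b "g a" "g b"] sep_close[OF s that] iso bij by (metis bij_betwE)
      qed
      have "central_form K (g ` ?sep ?e s) ?e u t v = central_form K (?sep ?e s) ?e u s v" for u v
      proof (rule central_form_transport)
        show "inj_on g (?sep ?e s)"
          using bij by (auto simp: bij_betw_def separator_def intro: inj_on_subset)
        show "K (g b) (g c) = K b c" if "b \<in> ?sep ?e s" "c \<in> ?sep ?e s" for b c
          using K_g that by blast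
        show "K ?e (g b) = K ?e b" "K t (g b) = K s b" if "b \<in> ?sep ?e s" for b
          using K_g[of ?e b] K_g[of s b] that unfolding g(2) ge by blast+
      qed
      then have "inner (R s v) u = inner (R t v) u" for u v
        using R[OF s] R[OF t] sep by simp
      then have "R s v = R t v" for v
        using vector_eq_rdot by blast
      then have "R s = R t" by (rule blinfun_eqI)
      then show ?thesis using s t by (simp add: \<psi>_def)
    qed
  qed
  show ?thesis
    using \<psi>_bounded pd' radial' by (intro bexI[of _ \<psi>]) (auto simp: \<psi>_def word_ball_def)
qed

text \<open>
  The extensions to successive balls are chosen so that each prolongs the previous one.  The kernel on a given
  finite set involves a single sufficiently late one of them.
\<close>

lemma positive_definite_extension:
  fixes \<phi> :: "'g word \<Rightarrow> 'h::chilbert_space \<Rightarrow>\<^sub>L 'h"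
  assumes A: "finite A" and \<phi>: "\<phi> \<in> word_ball A n \<rightarrow> bounded_operators"
    and pd: "positive_definite_on (free_group A) (word_ball A n) \<phi>"
  shows "\<exists>\<Phi> \<in> carrier (free_group A) \<rightarrow> bounded_operators.
    (\<forall>s \<in> word_ball A n. \<Phi> s = \<phi> s) \<and>
    positive_definite_on (free_group A) (carrier (free_group A)) \<Phi> \<and>
    (radial_on (word_ball A n) \<phi> \<longrightarrow> radial_on (carrier (free_group A)) \<Phi>)"
proof -
  let ?G = "free_group A" and ?F = "carrier (free_group A)"
  define P where "P m f \<longleftrightarrow> f \<in> word_ball A (n + m) \<rightarrow> bounded_operators \<and>
    positive_definite_on ?G (word_ball A (n + m)) f \<and> (\<forall>s \<in> word_ball A n. f s = \<phi> s) \<and>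
    (radial_on (word_ball A n) \<phi> \<longrightarrow> radial_on (word_ball A (n + m)) f)"
    for m and f :: "'g word \<Rightarrow> 'h \<Rightarrow>\<^sub>L 'h"
  have "\<exists>f. P 0 f" using \<phi> pd by (auto simp: P_def)
  moreover have "\<exists>f'. P (Suc m) f' \<and> (\<forall>s \<in> word_ball A (n + m). f' s = f s)" if "P m f" for m f
  proof -
    obtain f' where "f' \<in> word_ball A (Suc (n + m)) \<rightarrow> bounded_operators"
      "\<forall>s \<in> word_ball A (n + m). f' s = f s"
      "positive_definite_on ?G (word_ball A (Suc (n + m))) f'"
      "radial_on (word_ball A (n + m)) f \<longrightarrow> radial_on (word_ball A (Suc (n + m))) f'"
      using positive_definite_extension_step[OF A, of f "n + m"] \<open>P m f\<close> unfolding P_def by blast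
    moreover have "word_ball A n \<subseteq> word_ball A (n + m)" by (auto simp: word_ball_def)
    ultimately show ?thesis using \<open>P m f\<close> by (intro exI[of _ f']) (auto simp: P_def)
  qed
  ultimately obtain f where f: "\<And>m. P m (f m)"
    and step: "\<And>m s. s \<in> word_ball A (n + m) \<Longrightarrow> f (Suc m) s = f m s"
    using dependent_nat_choice[of P "\<lambda>m f f'. \<forall>s \<in> word_ball A (n + m). f' s = f s"] by metis
  have stable: "f (m + k) s = f m s" if "s \<in> word_ball A (n + m)" for m k s
  proof (induction k)
    case (Suc k)
    have "s \<in> word_ball A (n + (m + k))" using that by (simp add: word_ball_def)
    then show ?case using step[of s "m + k"] Suc by simp
  qed simp
  define \<Phi> where "\<Phi> s = f (length s) s" for s
  have \<Phi>_eq: "\<Phi> s = f m s" if "s \<in> word_ball A (n + m)" for s m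
  proof (cases "m \<le> length s")
    case True
    then show ?thesis using stable[OF that, of "length s - m"] by (simp add: \<Phi>_def)
  next
    case False
    have "s \<in> word_ball A (n + length s)" using that by (simp add: word_ball_def)
    then show ?thesis using stable[of s "length s" "m - length s"] False by (simp add: \<Phi>_def)
  qed
  have ball: "s \<in> word_ball A (n + length s)" if "s \<in> ?F" for s
    using that by (simp add: word_ball_def)
  have bounded: "\<Phi> \<in> ?F \<rightarrow> bounded_operators"
    using f ball unfolding P_def \<Phi>_def by blast
  have "positive_definite_on ?G ?F \<Phi>"
  proof (rule positive_definite_onI[OF bounded])
    fix Z assume Z: "finite Z" "Z \<subseteq> ?F"
    interpret group ?G by (rule group_free_group)
    \<comment> \<open>The \<open>0\<close> keeps the maximum defined when \<open>Z\<close> is empty.\<close>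
    define m where "m = Max (insert 0 ((\<lambda>(x, y). word_dist A x y) ` (Z \<times> Z)))"
    have "word_dist A x y \<le> m" if "x \<in> Z" "y \<in> Z" for x y
      unfolding m_def using that Z(1) by (intro Max_ge) force+
    then have in_ball: "inv\<^bsub>?G\<^esub> x \<otimes>\<^bsub>?G\<^esub> y \<in> word_ball A (n + m)" if "x \<in> Z" "y \<in> Z" for x y
      using that Z(2) inv_mult_in_word_ball_iff[of x A y "n + m"] by (meson subsetD trans_le_add2)
    then have "psd_kernel_on (\<lambda>x y. f m (inv\<^bsub>?G\<^esub> x \<otimes>\<^bsub>?G\<^esub> y)) Z"
      using f[of m] Z unfolding P_def
      by (intro positive_definite_on_imp_psd_kernel_on[where \<Sigma> = "word_ball A (n + m)"]) auto
    then show "psd_kernel_on (\<lambda>x y. \<Phi> (inv\<^bsub>?G\<^esub> x \<otimes>\<^bsub>?G\<^esub> y)) Z"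
      using psd_kernel_on_cong[of Z "\<lambda>x y. \<Phi> (inv\<^bsub>?G\<^esub> x \<otimes>\<^bsub>?G\<^esub> y)"
          "\<lambda>x y. f m (inv\<^bsub>?G\<^esub> x \<otimes>\<^bsub>?G\<^esub> y)"] \<Phi>_eq in_ball by blast
  qed
  moreover have "\<forall>s \<in> word_ball A n. \<Phi> s = \<phi> s"
    using f[of 0] \<Phi>_eq[of _ 0] by (simp add: P_def)
  moreover have "radial_on ?F \<Phi>" if "radial_on (word_ball A n) \<phi>"
    unfolding radial_on_def
  proof (intro ballI impI)
    fix s t assume "s \<in> ?F" "t \<in> ?F" "length s = length t"
    then show "\<Phi> s = \<Phi> t"
      using f[of "length s"] that ball[of s] ball[of t] unfolding P_def radial_on_def \<Phi>_def by metis
  qed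
  ultimately show ?thesis using bounded by blast
qed

theorem proposition4p4:
  fixes A :: "'g set" and n :: nat
    and \<phi> :: "'g word \<Rightarrow> ('h::chilbert_space \<Rightarrow>\<^sub>L 'h)"
  assumes "finite A" and "n \<ge> 1"
    and "\<phi> \<in> word_ball A n \<rightarrow> bounded_operators"
    and "positive_definite_on (free_group A) (word_ball A n) \<phi>"
    and "\<phi> \<one>\<^bsub>free_group A\<^esub> = id_blinfun"
  shows "(\<exists>\<Phi> \<in> carrier (free_group A) \<rightarrow> bounded_operators.
            (\<forall>s \<in> word_ball A n. \<Phi> s = \<phi> s) \<and>
            positive_definite_on (free_group A) (carrier (free_group A)) \<Phi>) \<and>
         (radial_on (word_ball A n) \<phi> \<longrightarrow>
          (\<exists>\<Phi> \<in> carrier (free_group A) \<rightarrow> bounded_operators.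
            (\<forall>s \<in> word_ball A n. \<Phi> s = \<phi> s) \<and>
            positive_definite_on (free_group A) (carrier (free_group A)) \<Phi> \<and>
            radial_on (carrier (free_group A)) \<Phi>))"
  using positive_definite_extension[OF assms(1,3,4)] by blast

end
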